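(* For every $\varepsilon\in[\frac1T,1]$, if $\mathcal B$ is the algorithm HTINF with parameters $\alpha=2$ and $\sigma=\sqrt6$ (on the action set $[K]$), then the Non-Private to Private Conversion procedure (defined in the context), run with $\mathcal B$, privacy parameter $\varepsilon$ and batch size $\tau=\lceil 1/\varepsilon\rceil$, is $\varepsilon$-differentially private and has worst-case expected regret over $T$ rounds at most $$O\left(\frac{\sqrt{TK}}{\sqrt\varepsilon}+\frac1\varepsilon\right),$$ where the constant hidden in $O(\cdot)$ is absolute.
   Context: $[K]=\{1,\dots,K\}$; $\Pi([K])$ is the set of probability distributions on $[K]$. $\operatorname{Lap}(\lambda)$ is the Laplace distribution with density $\frac1{2\lambda}e^{-|x|/\lambda}$. **Bandit algorithm.** A bandit algorithm with action set $[K]$ is a deterministic map $\mathcal A:\bigcup_{t\ge1}([K]\times\mathbb R)^{t-1}\to\Pi([K])$. In round $t$, given the history of past actions and observed losses $(I_s,\ell_s(I_s))_{s=1}^{t-1}$, it samples $I_t\sim\mathcal A((I_s,\ell_s(I_s))_{s<t})$ and then observes only $\ell_t(I_t)$. **Worst-case expected regret** over $T$ rounds: $\sup_{\ell_{1:T}}\bigl(\mathbb E[\sum_{t=1}^T\ell_t(I_t)]-\inf_{i\in[K]}\sum_{t=1}^T\ell_t(i)\bigr)$, over sequences of functions $\ell_t:[K]\to[0,1]$ fixed in advance, expectation over all randomness of the algorithm. **Differential privacy.** The algorithm is $\varepsilon$-differentially private if for every $T\in\mathbb N$, any two sequences $\ell_{1:T},\ell'_{1:T}$ of functions $[K]\to[0,1]$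 differing at exactly one time point, and any $E\subset[K]^T$, $\mathbb P[(I_1,\dots,I_T)\in E]\le e^\varepsilon\,\mathbb P[(I'_1,\dots,I'_T)\in E]$, where $I_{1:T}$ and $I'_{1:T}$ are the actions played on $\ell_{1:T}$ and $\ell'_{1:T}$. **Non-Private to Private Conversion.** Input: bandit algorithm $\mathcal B$, integer batch size $\tau\ge1$, $\varepsilon\in(0,1]$. Rounds are grouped in consecutive batches, batch $j$ being rounds $(j-1)\tau+1,\dots,j\tau$. At the start of batch $j$, receive an action $J_j$ from $\mathcal B$ (sampled from $\mathcal B$'s distribution given the pairs (action, value) it has been fed so far); play $J_j$ in every round of the batch. At the end of a complete batch $j$, feed $\mathcal B$ the value $\hat\ell_j(J_j)+Z_j$ as the observed loss of $J_j$, where $\hat\ell_j(i)=\frac1\tau\sum_{s=(j-1)\tau+1}^{j\tau}\ell_s(i)$ and $Z_j\sim\operatorname{Lap}(\frac1{\tau\varepsilon})$ is independent of everything else. **HTINF** (heavy-tail Tsallis-INF) is Algorithm 1 of J. Huang, Y. Dai, L. Huang, "Adaptive best-of-both-worlds algorithm for heavy-tailed multi-armed bandits", ICML 2022, a Follow-the-Regularized-Leader bandit algorithm for possibly negative, heavy-tailed losses, with parameters $\alpha\in(1,2]$ and $\sigma>0$. For $\alpha=2$ it reads: in round $t$, with learning rate $\eta_t=1/(\sigma\sqrt t)$, compute $x_t=\operatorname{argmin}_{x\in\Pi([K])}\bigl(\eta_t\sum_{s<t}\langle\hat\ell_s,x\rangle-2\sum_{i=1}^K\sqrt{x_i}\bigr)$;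 draw $I_t\sim x_t$ and receive the real loss value $v_t$ of $I_t$; with the skipping threshold $r_t=(1-2^{-1/3})\,\sigma\sqrt t\,\sqrt{x_{t,I_t}}$, set $\hat\ell_t=0$ if $|v_t|>r_t$, and otherwise $\hat\ell_t(i)=\frac{v_t}{x_{t,i}}\mathbb I\{I_t=i\}$ for $i\in[K]$. *)

theory Defs
  imports "HOL-Probability.Probability"
begin

text \<open>
  Actions are the natural numbers \<open>1, \<dots>, K\<close> and rounds are numbered from 1, so \<open>L t i\<close> is the loss of
  action \<open>i\<close> in round \<open>t\<close>. Only the values for \<open>t \<in> {1..T}\<close> and \<open>i \<in> {1..K}\<close> are ever used.
\<close>

definition action_dists :: "nat \<Rightarrow> nat pmf set" where
  "action_dists K = {p. set_pmf p \<subseteq> {1..K}}"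

definition loss_seqs :: "nat \<Rightarrow> nat \<Rightarrow> (nat \<Rightarrow> nat \<Rightarrow> real) set" where
  "loss_seqs K T = {L. \<forall>t\<in>{1..T}. \<forall>i\<in>{1..K}. L t i \<in> {0..1}}"

text \<open>
  A bandit algorithm maps the history, in chronological order, to the distribution of the next
  action. An online procedure as a whole (which may use further internal randomness) is given by
  the law of the list of actions \<open>[I\<^sub>1, \<dots>, I\<^sub>T]\<close> it plays, for every horizon \<open>T\<close> and loss sequence.
\<close>

type_synonym bandit_alg = "(nat \<times> real) list \<Rightarrow> nat pmf"
type_synonym procedure = "nat \<Rightarrow> (nat \<Rightarrow> nat \<Rightarrow> real) \<Rightarrow> nat list measure"

definition expected_regret :: "nat \<Rightarrow> procedure \<Rightarrow> nat \<Rightarrow> (nat \<Rightarrow> nat \<Rightarrow> real) \<Rightarrow> real" where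
  "expected_regret K P T L =
     (\<integral>I. (\<Sum>t=1..T. L t (I ! (t - 1))) \<partial>P T L) - (INF i\<in>{1..K}. \<Sum>t=1..T. L t i)"

definition worst_case_regret :: "nat \<Rightarrow> procedure \<Rightarrow> nat \<Rightarrow> ereal" where
  "worst_case_regret K P T = (SUP L\<in>loss_seqs K T. ereal (expected_regret K P T L))"

definition differentially_private :: "nat \<Rightarrow> real \<Rightarrow> procedure \<Rightarrow> bool" where
  "differentially_private K \<epsilon> P \<longleftrightarrow>
     (\<forall>T. \<forall>L\<in>loss_seqs K T. \<forall>L'\<in>loss_seqs K T.
        (\<exists>!t. t \<in> {1..T} \<and> (\<exists>i\<in>{1..K}. L t i \<noteq> L' t i)) \<longrightarrow>
        (\<forall>E \<subseteq> {I. length I = T \<and> set I \<subseteq> {1..K}}.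
           measure (P T L) E \<le> exp \<epsilon> * measure (P T L') E))"

definition laplace :: "real \<Rightarrow> real measure" where
  "laplace b = density lborel (\<lambda>x. ennreal (1 / (2 * b) * exp (- \<bar>x\<bar> / b)))"

text \<open>
  \<open>conversion_from B \<tau> \<epsilon> L s h n\<close> is the law of the next \<open>n\<close> actions of the conversion at the start of a
  batch, when \<open>s\<close> rounds have been played and \<open>B\<close> has been fed the history \<open>h\<close>. A last batch of
  fewer than \<open>\<tau>\<close> rounds yields no feedback. The value for \<open>\<tau> = 0\<close> only ensures termination.
\<close>

fun conversion_from ::
  "bandit_alg \<Rightarrow> nat \<Rightarrow> real \<Rightarrow> (nat \<Rightarrow> nat \<Rightarrow> real) \<Rightarrow> nat \<Rightarrow> (nat \<times> real) list \<Rightarrow> nat \<Rightarrow> nat list measure"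
where
  "conversion_from B \<tau> \<epsilon> L s h n =
    (if n = 0 \<or> \<tau> = 0 then return (count_space UNIV) []
     else do {
       J \<leftarrow> measure_pmf (B h);
       if n < \<tau> then return (count_space UNIV) (replicate n J)
       else do {
         Z \<leftarrow> laplace (1 / (real \<tau> * \<epsilon>));
         I \<leftarrow> conversion_from B \<tau> \<epsilon> L (s + \<tau>)
               (h @ [(J, (1 / real \<tau>) * (\<Sum>r=s+1..s+\<tau>. L r J) + Z)]) (n - \<tau>);
         return (count_space UNIV) (replicate \<tau> J @ I)
       }
     })"

declare conversion_from.simps [simp del]

definition private_conversion :: "bandit_alg \<Rightarrow> nat \<Rightarrow> real \<Rightarrow> procedure" where
  "private_conversion B \<tau> \<epsilon> T L = conversion_from B \<tau> \<epsilon> L 0 [] T"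

text \<open>
  Heavy-tail Tsallis-INF (J. Huang, Y. Dai, L. Huang, ICML 2022, Algorithm 1), specialised to the
  moment parameter \<open>\<alpha> = 2\<close>.
\<close>

definition htinf_rate :: "real \<Rightarrow> nat \<Rightarrow> real" where
  "htinf_rate \<sigma> t = 1 / (\<sigma> * sqrt (real t))"

definition htinf_threshold :: "real \<Rightarrow> nat \<Rightarrow> nat pmf \<Rightarrow> nat \<Rightarrow> real" where
  "htinf_threshold \<sigma> t x i = (1 - 2 powr (- 1 / 3)) * \<sigma> * sqrt (real t) * sqrt (pmf x i)"

text \<open>The loss estimate of round \<open>t\<close>, in which \<open>a\<close> was drawn from \<open>x\<close> and the value \<open>v\<close> was received.\<close>

definition htinf_estimate :: "real \<Rightarrow> nat \<Rightarrow> nat pmf \<Rightarrow> nat \<times> real \<Rightarrow> nat \<Rightarrow> real" where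
  "htinf_estimate \<sigma> t x = (\<lambda>(a, v) i.
     if \<bar>v\<bar> > htinf_threshold \<sigma> t x a then 0
     else if i = a then v / pmf x i else 0)"

text \<open>
  \<open>htinf K \<sigma> h\<close> is \<open>x\<^sub>t\<close> with \<open>t = length h + 1\<close>. The list index \<open>s\<close> stands for round \<open>s + 1\<close>, whose
  distribution is \<open>htinf K \<sigma> (take s h)\<close>. By strict convexity the minimiser is unique.
\<close>

function htinf :: "nat \<Rightarrow> real \<Rightarrow> bandit_alg" where
  "htinf K \<sigma> h =
     arg_min
       (\<lambda>x. htinf_rate \<sigma> (length h + 1) *
              (\<Sum>s<length h. \<Sum>i=1..K.
                 htinf_estimate \<sigma> (s + 1) (htinf K \<sigma> (take s h)) (h ! s) i * pmf x i)
            - 2 * (\<Sum>i=1..K. sqrt (pmf x i)))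
       (\<lambda>x. x \<in> action_dists K)"
  by auto
termination
  by (relation "Wellfounded.measure (\<lambda>(K, \<sigma>, h). length h)") auto

declare htinf.simps [simp del]

end

theory Submission imports Defs begin

text \<open>
  Privacy: changing one loss moves a single batch mean by at most \<open>1 / \<tau>\<close>, which Laplace noise of
  scale \<open>1 / (\<tau> \<epsilon>)\<close> hides up to a factor \<open>exp \<epsilon>\<close>; everything after that batch is post-processing.

  Regret: the values fed to HTINF have second moment at most \<open>6 = \<sigma>\<^sup>2\<close>. Let the potential of a history be
  the cumulative estimated loss of the comparator minus the value of the FTRL objective. By the
  FTRL identity, which is exact because the minimiser is interior, one batch decreases it by the estimated
  instantaneous regret up to a stability and a regularisation term. Skipping costs nothing for the
  comparator, as a Laplace variable with nonnegative mean has nonnegative truncated tails, and at most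
  the second moment over the threshold for the drawn action. Summing \<open>O(sqrt (K / m))\<close> over the
  \<open>T / \<tau>\<close> batches and multiplying by \<open>\<tau>\<close> gives the rate.
\<close>

text \<open>The obstacle is measurability: \<open>bind\<close> behaves as intended only for
  measurable kernels, while HTINF is given by \<open>arg_min\<close>. The remedy is the closed form
  of the minimiser, whose weights are 1 / (l i + c)^2 for a single Lagrange multiplier c;
  monotonicity in c makes c, and hence the weights, measurable in the fed values.

  Once the law is available as a recursion for nonnegative integrals, no filtration is introduced.
  Privacy and regret are backward inductions on the number of remaining rounds, started from an
  arbitrary history. The regret invariant is a value function: the comparator's remaining loss, plus
  \<tau> times the potential and the budget \<open>width\<close> for future batches, plus \<tau> for
  an incomplete last batch.

  The two skipping biases differ in kind. That of the drawn action J is multiplied by its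
  probability x_J, so a bound of order 1 / sqrt x_J is harmless. The importance weight of the
  comparator i cancels x_i, so the same bound would be left as 1 / sqrt x_i and could be arbitrarily
  large; hence the sign argument for the comparator.\<close>

subsection \<open>Laplace noise\<close>

text \<open>With absolute moments the integrand is even, so the integral is twice the one over the
  half-line, where the density is half of an exponential density. The case \<open>i = 0\<close>
  gives the total mass.\<close>

lemma laplace_density_moment:
  fixes b :: real
  assumes "b > 0"
  shows "has_bochner_integral lborel (\<lambda>x. 1 / (2 * b) * exp (- \<bar>x\<bar> / b) * \<bar>x\<bar> ^ i) (fact i * b ^ i)"
proof -
  have "has_bochner_integral lborel (\<lambda>x. exponential_density (1 / b) x * x ^ i) (fact i * b ^ i)"
  proof (rule has_bochner_integral_nn_integral)
    show "(\<integral>\<^sup>+ x. ennreal (exponential_density (1 / b) x * x ^ i) \<partial>lborel) = ennreal (fact i * b ^ i)"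
      using nn_integral_erlang_ith_moment[of "1 / b" 0 i] assms by (simp add: field_simps)
  qed (use assms in \<open>auto simp: exponential_density_def\<close>)
  hence "has_bochner_integral lborel (\<lambda>x. (1 / 2) * (exponential_density (1 / b) x * x ^ i))
           ((1 / 2) * (fact i * b ^ i))"
    by (intro has_bochner_integral_mult_right) auto
  hence "has_bochner_integral lborel
           (\<lambda>x. indicator {0..} x *\<^sub>R (1 / (2 * b) * exp (- \<bar>x\<bar> / b) * \<bar>x\<bar> ^ i)) ((1 / 2) * (fact i * b ^ i))"
    by (rule has_bochner_integral_cong[THEN iffD1, rotated 3])
       (auto simp: exponential_density_def indicator_def)
  from has_bochner_integral_even_function[OF this] show ?thesis by simp
qed

lemma space_laplace [simp]: "space (laplace b) = UNIV"
  and sets_laplace [measurable_cong, simp]: "sets (laplace b) = sets borel"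
  by (simp_all add: laplace_def)

lemma prob_space_laplace: "b > 0 \<Longrightarrow> prob_space (laplace b)"
  using laplace_density_moment[of b 0]
  by (intro prob_spaceI)
     (auto simp: laplace_def emeasure_density has_bochner_integral_iff nn_integral_eq_integral)

lemma laplace_integrable_iff:
  fixes f :: "real \<Rightarrow> real"
  assumes "b > 0" and [measurable]: "f \<in> borel_measurable borel"
  shows "integrable (laplace b) f \<longleftrightarrow> integrable lborel (\<lambda>x. 1 / (2 * b) * exp (- \<bar>x\<bar> / b) * f x)"
  using assms(1) unfolding laplace_def by (subst integrable_density) auto

lemma laplace_integral:
  fixes f :: "real \<Rightarrow> real"
  assumes "b > 0" and [measurable]: "f \<in> borel_measurable borel"
  shows "integral\<^sup>L (laplace b) f = (\<integral>x. 1 / (2 * b) * exp (- \<bar>x\<bar> / b) * f x \<partial>lborel)"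
  using assms(1) unfolding laplace_def by (subst integral_density) auto

lemma laplace_abs_moment:
  assumes "b > 0"
  shows "integrable (laplace b) (\<lambda>x. \<bar>x\<bar> ^ i)" "(\<integral>x. \<bar>x\<bar> ^ i \<partial>laplace b) = fact i * b ^ i"
  using laplace_density_moment[OF assms, of i] assms
  by (simp_all add: laplace_integrable_iff laplace_integral has_bochner_integral_iff)

lemma laplace_reflect:
  fixes f :: "real \<Rightarrow> real"
  assumes "b > 0" and [measurable]: "f \<in> borel_measurable borel"
  shows "(\<integral>x. f (- x) \<partial>laplace b) = integral\<^sup>L (laplace b) f"
proof -
  have "(\<integral>x. 1 / (2 * b) * exp (- \<bar>x\<bar> / b) * f x \<partial>lborel)
      = (\<integral>x. 1 / (2 * b) * exp (- \<bar>- x\<bar> / b) * f (- x) \<partial>lborel)"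
    using lborel_integral_real_affine[of "-1" "\<lambda>x. 1 / (2 * b) * exp (- \<bar>x\<bar> / b) * f x" 0] by simp
  thus ?thesis using assms(1) by (simp add: laplace_integral)
qed

lemma laplace_integrable_ident: "b > 0 \<Longrightarrow> integrable (laplace b) (\<lambda>x. x)"
  using laplace_abs_moment(1)[of b 1] integrable_abs_iff[of "\<lambda>x. x" "laplace b"] by simp

lemma laplace_mean: "b > 0 \<Longrightarrow> (\<integral>x. x \<partial>laplace b) = 0"
  using laplace_reflect[of b "\<lambda>x. x"] by simp

text \<open>The cross term has mean zero, which leaves a^2 + 2 b^2 \<le> 3. The coarser 6 is the
  square of the parameter \<open>sqrt 6\<close> of HTINF.\<close>

lemma laplace_shifted_second_moment:
  assumes "0 < b" "b \<le> 1" "0 \<le> a" "a \<le> 1"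
  shows "integrable (laplace b) (\<lambda>z. (a + z)\<^sup>2)" "(\<integral>z. (a + z)\<^sup>2 \<partial>laplace b) \<le> 6"
proof -
  interpret prob_space "laplace b" by (rule prob_space_laplace) fact
  note sq = laplace_abs_moment[OF assms(1), of 2, simplified]
  have eq: "(\<lambda>z. (a + z)\<^sup>2) = (\<lambda>z. a\<^sup>2 + (2 * a * z + z\<^sup>2))"
    by (auto simp: power2_eq_square algebra_simps)
  show "integrable (laplace b) (\<lambda>z. (a + z)\<^sup>2)"
    unfolding eq using sq(1) laplace_integrable_ident[OF assms(1)] by simp
  have "(\<integral>z. (a + z)\<^sup>2 \<partial>laplace b) = a\<^sup>2 + 2 * b\<^sup>2"
    unfolding eq using sq laplace_integrable_ident[OF assms(1)] laplace_mean[OF assms(1)]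
    by (simp add: prob_space[simplified])
  also have "\<dots> \<le> 1 + 2 * 1"
    using assms by (intro add_mono mult_left_mono power_le_one) auto
  finally show "(\<integral>z. (a + z)\<^sup>2 \<partial>laplace b) \<le> 6" by simp
qed

section \<open>Skipping applied to Laplace feedback\<close>

definition trunc :: "real \<Rightarrow> real \<Rightarrow> real" where
  "trunc r v = (if \<bar>v\<bar> > r then 0 else v)"

lemma trunc_measurable [measurable]: "trunc r \<in> borel_measurable borel"
  unfolding trunc_def [abs_def] by measurable

lemma abs_trunc_le: "\<bar>trunc r v\<bar> \<le> \<bar>v\<bar>"
  by (simp add: trunc_def)

lemma laplace_integrable_trunc:
  assumes "b > 0"
  shows "integrable (laplace b) (\<lambda>z. trunc r (a + z))"
proof (rule Bochner_Integration.integrable_bound)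
  interpret prob_space "laplace b" by (rule prob_space_laplace) fact
  show "integrable (laplace b) (\<lambda>z. a + z)"
    using laplace_integrable_ident[OF assms] by simp
qed (use abs_trunc_le in auto)

text \<open>The discarded part \<open>v - trunc r v\<close> is an odd function of \<open>v = a + z\<close>, and for \<open>a \<ge> 0\<close> the
  shifted density gives more weight to \<open>v\<close> than to \<open>- v\<close> whenever \<open>v \<ge> 0\<close>.\<close>

lemma laplace_trunc_mean_le:
  assumes "b > 0" "a \<ge> 0"
  shows "(\<integral>z. trunc r (a + z) \<partial>laplace b) \<le> a"
proof -
  interpret prob_space "laplace b" by (rule prob_space_laplace) fact
  define f where "f v = v - trunc r v" for v
  define p where "p x = 1 / (2 * b) * exp (- \<bar>x\<bar> / b)" for x :: real
  have [measurable]: "f \<in> borel_measurable borel" "p \<in> borel_measurable borel"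
    unfolding f_def [abs_def] p_def [abs_def] by measurable
  have f_odd: "f (- v) = - f v" and f_nonneg: "v \<ge> 0 \<Longrightarrow> f v \<ge> 0" for v
    by (auto simp: f_def trunc_def)
  have p_even: "p (- x) = p x" for x by (simp add: p_def)
  have int: "integrable (laplace b) (\<lambda>z. f (a + z))"
    unfolding f_def using laplace_integrable_ident[OF assms(1)] laplace_integrable_trunc[OF assms(1)] by simp
  hence "integrable lborel (\<lambda>z. p z * f (a + z))"
    using assms(1) by (simp add: laplace_integrable_iff p_def)
  hence int1: "integrable lborel (\<lambda>v. p (v - a) * f v)"
    using lborel_integrable_real_affine[of "\<lambda>z. p z * f (a + z)" 1 "- a"] by simp
  hence int2: "integrable lborel (\<lambda>v. p (v + a) * f v)"
    using lborel_integrable_real_affine[of "\<lambda>v. p (v - a) * f v" "- 1" 0] p_even[of "v + a" for v]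
    by (simp add: f_odd algebra_simps)
  let ?I = "\<integral>v. p (v - a) * f v \<partial>lborel"
  have I: "(\<integral>z. f (a + z) \<partial>laplace b) = ?I"
    using assms(1) lborel_integral_real_affine[of 1 "\<lambda>z. p z * f (a + z)" "- a"]
    by (simp add: laplace_integral p_def)
  have "?I = - (\<integral>v. p (v + a) * f v \<partial>lborel)"
    using lborel_integral_real_affine[of "- 1" "\<lambda>v. p (v - a) * f v" 0] p_even[of "v + a" for v]
    by (simp add: f_odd algebra_simps)
  \<comment> \<open>Adding the integral to its reflected form symmetrises the integrand, which then
    has a sign pointwise.\<close>
  hence "2 * ?I = (\<integral>v. p (v - a) * f v - p (v + a) * f v \<partial>lborel)"
    using int1 int2 by simp
  also have "\<dots> \<ge> 0"
  proof (rule Bochner_Integration.integral_nonneg)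
    fix v :: real
    have mono: "p y \<le> p x" if "\<bar>x\<bar> \<le> \<bar>y\<bar>" for x y
      using that assms(1) by (auto simp: p_def intro!: mult_left_mono divide_right_mono)
    have "0 \<le> (p (v - a) - p (v + a)) * f v"
    proof (cases "v \<ge> 0")
      case True
      thus ?thesis using mono[of "v - a" "v + a"] f_nonneg[of v] assms(2) by (intro mult_nonneg_nonneg) auto
    next
      case False
      thus ?thesis using mono[of "v + a" "v - a"] f_nonneg[of "- v"] f_odd[of v] assms(2)
        by (intro mult_nonpos_nonpos) auto
    qed
    thus "0 \<le> p (v - a) * f v - p (v + a) * f v" by (simp add: algebra_simps)
  qed
  finally have "(\<integral>z. f (a + z) \<partial>laplace b) \<ge> 0" using I by simp
  thus ?thesis
    unfolding f_def using assms laplace_integrable_ident[OF assms(1)] laplace_integrable_trunc[OF assms(1)]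
    by (simp add: laplace_mean prob_space[simplified])
qed

text \<open>A discarded value satisfies \<bar>v\<bar> > r, hence v \<le> v^2 / r; a kept value
  contributes nothing. Integrating this pointwise bound brings in the second moment.\<close>

lemma laplace_trunc_mean_ge:
  assumes "0 < b" "b \<le> 1" "0 \<le> a" "a \<le> 1" "r > 0"
  shows "a - (\<integral>z. trunc r (a + z) \<partial>laplace b) \<le> 6 / r"
proof -
  interpret prob_space "laplace b" by (rule prob_space_laplace) fact
  note [simp] = laplace_integrable_ident[OF assms(1)] laplace_integrable_trunc[OF assms(1)]
  have "a - (\<integral>z. trunc r (a + z) \<partial>laplace b) = (\<integral>z. (a + z) - trunc r (a + z) \<partial>laplace b)"
    using assms(1) by (simp add: laplace_mean prob_space[simplified])
  also have "\<dots> \<le> (\<integral>z. (a + z)\<^sup>2 / r \<partial>laplace b)"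
  proof (rule integral_mono)
    fix z
    have "v - trunc r v \<le> v\<^sup>2 / r" for v
    proof (cases "\<bar>v\<bar> > r")
      case True
      hence "r * v \<le> \<bar>v\<bar> * \<bar>v\<bar>" using assms(5)
        by (smt (verit) mult_mono abs_ge_self mult_left_mono mult_right_mono)
      thus ?thesis using True assms(5) by (simp add: trunc_def field_simps power2_eq_square)
    next
      case False
      thus ?thesis using assms(5) by (simp add: trunc_def)
    qed
    thus "a + z - trunc r (a + z) \<le> (a + z)\<^sup>2 / r" .
  qed (use assms laplace_shifted_second_moment in auto)
  also have "\<dots> \<le> 6 / r"
    using laplace_shifted_second_moment(2)[OF assms(1-4)] assms(5) by (simp add: divide_right_mono)
  finally show ?thesis .
qed

text \<open>Substituting v = c + z integrates the same \<open>g\<close> against two shifted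
  densities, whose ratio is at most exp \<epsilon> by the triangle inequality. An arbitrary
  nonnegative \<open>g\<close> can stand for everything that happens after the noisy value is
  released.\<close>

lemma laplace_shift_le:
  fixes g :: "real \<Rightarrow> ennreal"
  assumes "b > 0" and [measurable]: "g \<in> borel_measurable borel" and "\<bar>c - c'\<bar> \<le> b * \<epsilon>"
  shows "(\<integral>\<^sup>+z. g (c + z) \<partial>laplace b) \<le> ennreal (exp \<epsilon>) * (\<integral>\<^sup>+z. g (c' + z) \<partial>laplace b)"
proof -
  define p where "p x = 1 / (2 * b) * exp (- \<bar>x\<bar> / b)" for x :: real
  have [measurable]: "p \<in> borel_measurable borel" unfolding p_def [abs_def] by measurable
  have eq: "(\<integral>\<^sup>+z. g (c + z) \<partial>laplace b) = (\<integral>\<^sup>+v. ennreal (p (v - c)) * g v \<partial>lborel)" for c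
    unfolding laplace_def
    by (subst nn_integral_density)
       (use nn_integral_real_affine[of "\<lambda>v. ennreal (p (v - c)) * g v" 1 c] in \<open>auto simp: p_def\<close>)
  have "p (v - c) \<le> exp \<epsilon> * p (v - c')" for v
  proof -
    have "\<bar>v - c'\<bar> \<le> b * \<epsilon> + \<bar>v - c\<bar>" using assms(3) by linarith
    hence "- \<bar>v - c\<bar> / b \<le> \<epsilon> + - \<bar>v - c'\<bar> / b" using assms(1) by (simp add: field_simps)
    thus ?thesis using assms(1) by (simp add: p_def exp_add[symmetric] divide_right_mono)
  qed
  hence le: "ennreal (p (v - c)) \<le> ennreal (exp \<epsilon>) * ennreal (p (v - c'))" for v
    by (simp add: ennreal_mult'[symmetric] ennreal_leI)
  have "(\<integral>\<^sup>+z. g (c + z) \<partial>laplace b) \<le> (\<integral>\<^sup>+v. ennreal (exp \<epsilon>) * (ennreal (p (v - c')) * g v) \<partial>lborel)"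
    unfolding eq by (intro nn_integral_mono) (use le in \<open>auto simp: mult.assoc[symmetric] intro!: mult_right_mono\<close>)
  also have "\<dots> = ennreal (exp \<epsilon>) * (\<integral>\<^sup>+z. g (c' + z) \<partial>laplace b)"
    unfolding eq by (subst nn_integral_cmult) auto
  finally show ?thesis .
qed

subsection \<open>Minimisers of the Tsallis-regularised objective\<close>

text \<open>Here \<open>c\<close> is the Lagrange multiplier of the constraint that the weights sum
  to 1. With m the least \<open>l i\<close> and n the number of actions, the intermediate value
  theorem applies between 1 - m, where the least entry alone contributes 1, and sqrt n - m, where
  every term is at most 1 / n.\<close>

lemma tsallis_normaliser_exists:
  fixes l :: "'a \<Rightarrow> real"
  assumes "finite A" "A \<noteq> {}"
  shows "\<exists>c. (\<forall>i\<in>A. l i + c > 0) \<and> (\<Sum>i\<in>A. 1 / (l i + c)\<^sup>2) = 1"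
proof -
  define m where "m = Min (l ` A)"
  obtain k where k: "k \<in> A" "l k = m"
    using assms unfolding m_def by (metis (mono_tags, lifting) Min_in finite_imageI image_iff image_is_empty)
  have m_le: "m \<le> l i" if "i \<in> A" for i using that assms unfolding m_def by simp
  define n where "n = real (card A)"
  have n: "n \<ge> 1" using assms by (simp add: n_def Suc_leI card_gt_0_iff)
  let ?g = "\<lambda>c. \<Sum>i\<in>A. 1 / (l i + c)\<^sup>2"
  have "\<exists>c\<ge>1 - m. c \<le> sqrt n - m \<and> ?g c = 1"
  proof (rule IVT2')
    show "?g (sqrt n - m) \<le> 1"
    proof -
      have "?g (sqrt n - m) \<le> (\<Sum>i\<in>A. 1 / n)"
      proof (rule sum_mono)
        fix i assume "i \<in> A"
        hence "sqrt n \<le> l i + (sqrt n - m)" using m_le by simp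
        hence "(sqrt n)\<^sup>2 \<le> (l i + (sqrt n - m))\<^sup>2" by (rule power_mono) (use n in auto)
        thus "1 / (l i + (sqrt n - m))\<^sup>2 \<le> 1 / n" using n by (intro frac_le) auto
      qed
      also have "\<dots> = 1" using n by (simp add: n_def)
      finally show ?thesis .
    qed
    have "1 / (l k + (1 - m))\<^sup>2 \<le> ?g (1 - m)" by (rule member_le_sum) (use k assms in auto)
    thus "1 \<le> ?g (1 - m)" using k by simp
    show "1 - m \<le> sqrt n - m" using n by simp
    show "continuous_on {1 - m..sqrt n - m} ?g"
      by (intro continuous_intros) (use m_le in fastforce)
  qed
  then obtain c where "c \<ge> 1 - m" "?g c = 1" by blast
  moreover from this(1) have "\<forall>i\<in>A. l i + c > 0" using m_le by force
  ultimately show ?thesis by blast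
qed

text \<open>The Bregman divergence of \<open>x \<mapsto> - 2 (\<Sum>i\<in>A. sqrt (x i))\<close> is the last sum below.\<close>

lemma tsallis_objective_eq:
  fixes l x y :: "'a \<Rightarrow> real"
  assumes x: "\<And>i. i \<in> A \<Longrightarrow> x i > 0" "\<And>i. i \<in> A \<Longrightarrow> l i + c = 1 / sqrt (x i)"
    and y: "\<And>i. i \<in> A \<Longrightarrow> y i \<ge> 0" and sums: "sum x A = sum y A"
  shows "(\<Sum>i\<in>A. l i * y i) - 2 * (\<Sum>i\<in>A. sqrt (y i)) =
         (\<Sum>i\<in>A. l i * x i) - 2 * (\<Sum>i\<in>A. sqrt (x i)) + (\<Sum>i\<in>A. (sqrt (y i) - sqrt (x i))\<^sup>2 / sqrt (x i))"
proof -
  have "(sqrt (y i) - sqrt (x i))\<^sup>2 / sqrt (x i) =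
        l i * y i - l i * x i - 2 * sqrt (y i) + 2 * sqrt (x i) + c * (y i - x i)" if "i \<in> A" for i
  proof -
    have s: "sqrt (x i) > 0" "x i = (sqrt (x i))\<^sup>2" "y i = (sqrt (y i))\<^sup>2" using x(1)[OF that] y[OF that] by auto
    have l: "l i = 1 / sqrt (x i) - c" using x(2)[OF that] by simp
    show ?thesis unfolding l using s(1)
      by (subst (3 4) s(2), subst (2 4) s(3)) (simp add: field_simps power2_eq_square)
  qed
  hence "(\<Sum>i\<in>A. (sqrt (y i) - sqrt (x i))\<^sup>2 / sqrt (x i)) =
     (\<Sum>i\<in>A. l i * y i - l i * x i - 2 * sqrt (y i) + 2 * sqrt (x i) + c * (y i - x i))" by simp
  also have "\<dots> = (\<Sum>i\<in>A. l i * y i) - (\<Sum>i\<in>A. l i * x i) - 2 * (\<Sum>i\<in>A. sqrt (y i))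
      + 2 * (\<Sum>i\<in>A. sqrt (x i)) + c * (sum y A - sum x A)"
    by (simp add: sum.distrib sum_subtractf flip: sum_distrib_left)
  finally show ?thesis using sums by simp
qed

lemma sum_pmf_action_dists: "p \<in> action_dists K \<Longrightarrow> (\<Sum>i=1..K. pmf p i) = 1"
  by (rule sum_pmf_eq_1) (auto simp: action_dists_def)

lemma pmf_outside_action_dists: "p \<in> action_dists K \<Longrightarrow> i \<notin> {1..K} \<Longrightarrow> pmf p i = 0"
  unfolding action_dists_def by (metis mem_Collect_eq pmf_eq_0_set_pmf subsetD)

lemma pmf_eq_action_dists:
  assumes "p \<in> action_dists K" "q \<in> action_dists K" "\<And>i. i \<in> {1..K} \<Longrightarrow> pmf p i = pmf q i"
  shows "p = q"
proof (rule pmf_eqI)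
  fix i show "pmf p i = pmf q i"
    using assms pmf_outside_action_dists by (cases "i \<in> {1..K}") metis+
qed

text \<open>\<open>arg_min\<close> is a choice operator, so it says something only once a minimiser
  exists. The stationary point \<open>q\<close> is one, since any other distribution exceeds its
  value by a Bregman divergence; a zero divergence forces equality, so the chosen \<open>p\<close>
  is \<open>q\<close>.\<close>

lemma arg_min_tsallis:
  fixes l :: "nat \<Rightarrow> real"
  assumes "K \<ge> 1"
  defines "p \<equiv> arg_min (\<lambda>x. (\<Sum>i=1..K. l i * pmf x i) - 2 * (\<Sum>i=1..K. sqrt (pmf x i))) (\<lambda>x. x \<in> action_dists K)"
  shows "p \<in> action_dists K"
    and "\<exists>c. (\<forall>i\<in>{1..K}. l i + c > 0 \<and> pmf p i = 1 / (l i + c)\<^sup>2)"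
proof -
  let ?F = "\<lambda>x. (\<Sum>i=1..K. l i * pmf x i) - 2 * (\<Sum>i=1..K. sqrt (pmf x i))"
  obtain c where c: "\<And>i. i \<in> {1..K} \<Longrightarrow> l i + c > 0" "(\<Sum>i=1..K. 1 / (l i + c)\<^sup>2) = 1"
  proof -
    have "{1..K} \<noteq> {}" using assms(1) by simp
    from tsallis_normaliser_exists[OF finite_atLeastAtMost this, of l] show ?thesis using that by blast
  qed
  define q where "q = embed_pmf (\<lambda>i. if i \<in> {1..K} then 1 / (l i + c)\<^sup>2 else 0)"
  have q: "pmf q i = (if i \<in> {1..K} then 1 / (l i + c)\<^sup>2 else 0)" for i
    unfolding q_def
  proof (rule pmf_embed_pmf)
    have "(\<integral>\<^sup>+ i. ennreal (if i \<in> {1..K} then 1 / (l i + c)\<^sup>2 else 0) \<partial>count_space UNIV) =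
          (\<Sum>i=1..K. ennreal (1 / (l i + c)\<^sup>2))"
      by (subst nn_integral_count_space'[where A = "{1..K}"]) (auto intro!: sum.cong)
    also have "\<dots> = ennreal (\<Sum>i=1..K. 1 / (l i + c)\<^sup>2)" by (rule sum_ennreal) auto
    finally show "(\<integral>\<^sup>+ i. ennreal (if i \<in> {1..K} then 1 / (l i + c)\<^sup>2 else 0) \<partial>count_space UNIV) = 1"
      using c(2) by simp
    show "0 \<le> (if i \<in> {1..K} then 1 / (l i + c)\<^sup>2 else 0)" for i by simp
  qed
  have q_dist: "q \<in> action_dists K"
    by (auto simp: action_dists_def set_pmf_iff q split: if_splits)
  have q_pos: "pmf q i > 0" and q_opt: "l i + c = 1 / sqrt (pmf q i)" if "i \<in> {1..K}" for i
    using that c(1)[OF that] by (simp_all add: q real_sqrt_divide)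
  have F: "?F y = ?F q + (\<Sum>i=1..K. (sqrt (pmf y i) - sqrt (pmf q i))\<^sup>2 / sqrt (pmf q i))"
    if "y \<in> action_dists K" for y
  proof (rule tsallis_objective_eq[where c = c and x = "pmf q" and y = "pmf y" and l = l and A = "{1..K}"])
    show "sum (pmf q) {1..K} = sum (pmf y) {1..K}"
      using sum_pmf_action_dists[OF that] sum_pmf_action_dists[OF q_dist] by (rule trans[OF _ sym, rotated])
    show "pmf q i > 0" "l i + c = 1 / sqrt (pmf q i)" "pmf y i \<ge> 0" if "i \<in> {1..K}" for i
      using q_pos[OF that] q_opt[OF that] by simp_all
  qed
  have nn: "(\<Sum>i=1..K. (sqrt (pmf y i) - sqrt (pmf q i))\<^sup>2 / sqrt (pmf q i)) \<ge> 0" for y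
    by (intro sum_nonneg) auto
  have "is_arg_min ?F (\<lambda>x. x \<in> action_dists K) q"
    unfolding is_arg_min_linorder
  proof (intro conjI allI impI)
    show "q \<in> action_dists K" by (rule q_dist)
    fix y assume "y \<in> action_dists K"
    from F[OF this] nn[of y] show "?F q \<le> ?F y" by linarith
  qed
  hence "is_arg_min ?F (\<lambda>x. x \<in> action_dists K) p"
    unfolding p_def arg_min_def by (rule someI)
  hence p: "p \<in> action_dists K" "?F p \<le> ?F q" using q_dist by (auto simp: is_arg_min_linorder)
  have "(\<Sum>i=1..K. (sqrt (pmf p i) - sqrt (pmf q i))\<^sup>2 / sqrt (pmf q i)) = 0"
    using F[OF p(1)] p(2) nn[of p] by linarith
  hence zero: "(sqrt (pmf p i) - sqrt (pmf q i))\<^sup>2 / sqrt (pmf q i) = 0" if "i \<in> {1..K}" for i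
    using that sum_nonneg_0[of "{1..K}" "\<lambda>i. (sqrt (pmf p i) - sqrt (pmf q i))\<^sup>2 / sqrt (pmf q i)" i] by simp
  have "pmf p i = pmf q i" if "i \<in> {1..K}" for i
    using zero[OF that] q_pos[OF that] by simp
  hence "p = q" by (rule pmf_eq_action_dists[OF p(1) q_dist])
  show "p \<in> action_dists K" by (rule p(1))
  show "\<exists>c. (\<forall>i\<in>{1..K}. l i + c > 0 \<and> pmf p i = 1 / (l i + c)\<^sup>2)"
    unfolding \<open>p = q\<close> using c(1) by (intro exI[of _ c]) (simp add: q)
qed

section \<open>Closed form of HTINF and its measurability in the fed values\<close>

definition cum_loss :: "nat \<Rightarrow> real \<Rightarrow> (nat \<times> real) list \<Rightarrow> nat \<Rightarrow> real" where
  "cum_loss K \<sigma> h i =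
     (\<Sum>s<length h. htinf_estimate \<sigma> (s + 1) (htinf K \<sigma> (take s h)) (h ! s) i)"

lemma htinf_eq:
  "htinf K \<sigma> h = arg_min (\<lambda>x. (\<Sum>i=1..K. htinf_rate \<sigma> (length h + 1) * cum_loss K \<sigma> h i * pmf x i)
      - 2 * (\<Sum>i=1..K. sqrt (pmf x i))) (\<lambda>x. x \<in> action_dists K)"
proof -
  have "htinf_rate \<sigma> (length h + 1) * (\<Sum>s<length h. \<Sum>i=1..K.
          htinf_estimate \<sigma> (s + 1) (htinf K \<sigma> (take s h)) (h ! s) i * pmf x i)
      = (\<Sum>i=1..K. htinf_rate \<sigma> (length h + 1) * cum_loss K \<sigma> h i * pmf x i)" for x
    unfolding cum_loss_def sum_distrib_left sum_distrib_right by (subst sum.swap) (simp add: mult.assoc)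
  thus ?thesis by (subst htinf.simps) simp
qed

lemma htinf_minimiser:
  assumes "K \<ge> 1"
  shows htinf_action_dists: "htinf K \<sigma> h \<in> action_dists K"
    and htinf_normaliser: "\<exists>c. \<forall>i\<in>{1..K}. htinf_rate \<sigma> (length h + 1) * cum_loss K \<sigma> h i + c > 0 \<and>
      pmf (htinf K \<sigma> h) i = 1 / (htinf_rate \<sigma> (length h + 1) * cum_loss K \<sigma> h i + c)\<^sup>2"
  using arg_min_tsallis[OF assms, of "\<lambda>i. htinf_rate \<sigma> (length h + 1) * cum_loss K \<sigma> h i"]
  unfolding htinf_eq[symmetric] by blast+

text \<open>It suffices that the normaliser c is measurable. As long as all l i + a are positive,
  the sum of 1 / (l i + a)^2 strictly decreases in a, so c \<le> a can be tested by the value of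
  that sum at a, a condition involving only the measurable functions \<open>l i\<close>.\<close>

lemma tsallis_weights_measurable:
  fixes l :: "nat \<Rightarrow> 'b \<Rightarrow> real" and q :: "nat \<Rightarrow> 'b \<Rightarrow> real"
  assumes [measurable]: "\<And>i. i \<in> {1..K} \<Longrightarrow> l i \<in> borel_measurable M"
    and q: "\<And>\<omega>. \<exists>c. \<forall>i\<in>{1..K}. l i \<omega> + c > 0 \<and> q i \<omega> = 1 / (l i \<omega> + c)\<^sup>2"
    and sum_q: "\<And>\<omega>. (\<Sum>i=1..K. q i \<omega>) = 1"
    and i: "i \<in> {1..K}"
  shows "q i \<in> borel_measurable M"
proof -
  from q obtain c where c: "\<And>\<omega> i. i \<in> {1..K} \<Longrightarrow> l i \<omega> + c \<omega> > 0"
    "\<And>\<omega> i. i \<in> {1..K} \<Longrightarrow> q i \<omega> = 1 / (l i \<omega> + c \<omega>)\<^sup>2" by metis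
  have sum_c: "(\<Sum>i=1..K. 1 / (l i \<omega> + c \<omega>)\<^sup>2) = 1" for \<omega>
    using sum_q[of \<omega>] c(2) by simp
  have "c \<omega> \<le> a \<longleftrightarrow> (\<forall>i\<in>{1..K}. l i \<omega> + a > 0) \<and> (\<Sum>i=1..K. 1 / (l i \<omega> + a)\<^sup>2) \<le> 1" for \<omega> a
  proof
    assume le: "c \<omega> \<le> a"
    have "(\<Sum>i=1..K. 1 / (l i \<omega> + a)\<^sup>2) \<le> (\<Sum>i=1..K. 1 / (l i \<omega> + c \<omega>)\<^sup>2)"
    proof (rule sum_mono)
      fix i assume "i \<in> {1..K}"
      from c(1)[OF this, of \<omega>] show "1 / (l i \<omega> + a)\<^sup>2 \<le> 1 / (l i \<omega> + c \<omega>)\<^sup>2"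
        using le by (intro divide_left_mono power_mono) auto
    qed
    thus "(\<forall>i\<in>{1..K}. l i \<omega> + a > 0) \<and> (\<Sum>i=1..K. 1 / (l i \<omega> + a)\<^sup>2) \<le> 1"
      using c(1)[of _ \<omega>] le sum_c[of \<omega>] by force
  next
    assume a: "(\<forall>i\<in>{1..K}. l i \<omega> + a > 0) \<and> (\<Sum>i=1..K. 1 / (l i \<omega> + a)\<^sup>2) \<le> 1"
    show "c \<omega> \<le> a"
    proof (rule ccontr)
      assume "\<not> c \<omega> \<le> a"
      have "(\<Sum>i=1..K. 1 / (l i \<omega> + c \<omega>)\<^sup>2) < (\<Sum>i=1..K. 1 / (l i \<omega> + a)\<^sup>2)"
      proof (rule sum_strict_mono)
        fix i assume "i \<in> {1..K}"
        with a have "l i \<omega> + a > 0" by blast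
        thus "1 / (l i \<omega> + c \<omega>)\<^sup>2 < 1 / (l i \<omega> + a)\<^sup>2"
          using \<open>\<not> c \<omega> \<le> a\<close> by (intro divide_strict_left_mono power_strict_mono) auto
      qed (use i in auto)
      thus False using a sum_c[of \<omega>] by simp
    qed
  qed
  hence "{\<omega> \<in> space M. c \<omega> \<le> a} =
     {\<omega> \<in> space M. (\<forall>i\<in>{1..K}. l i \<omega> + a > 0) \<and> (\<Sum>i=1..K. 1 / (l i \<omega> + a)\<^sup>2) \<le> 1}" for a
    by simp
  moreover have "{\<omega> \<in> space M. (\<forall>i\<in>{1..K}. l i \<omega> + a > 0) \<and> (\<Sum>i=1..K. 1 / (l i \<omega> + a)\<^sup>2) \<le> 1} \<in> sets M" for a
    by measurable
  ultimately have [measurable]: "c \<in> borel_measurable M" by (simp add: borel_measurable_iff_le)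
  have "(\<lambda>\<omega>. 1 / (l i \<omega> + c \<omega>)\<^sup>2) \<in> borel_measurable M" using i by measurable
  also have "(\<lambda>\<omega>. 1 / (l i \<omega> + c \<omega>)\<^sup>2) = q i" using c(2)[OF i] by auto
  finally show ?thesis .
qed

text \<open>The actions are kept as a fixed discrete list and the fed values are read off the first
  coordinates of \<omega>. Measurability in a history then means measurability on a real product
  space, and no sigma-algebra on lists of pairs has to be chosen.\<close>

abbreviation hist :: "nat list \<Rightarrow> (nat \<Rightarrow> real) \<Rightarrow> (nat \<times> real) list" where
  "hist as \<omega> \<equiv> zip as (map \<omega> [0..<length as])"

abbreviation noise_space :: "(nat \<Rightarrow> real) measure" where
  "noise_space \<equiv> Pi\<^sub>M UNIV (\<lambda>_. borel)"

lemma take_hist: "s \<le> length as \<Longrightarrow> take s (hist as \<omega>) = hist (take s as) \<omega>"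
  by (simp add: take_zip take_map min_def)

text \<open>Coordinate \<open>length as\<close> is not read by \<open>hist as\<close>, so it is free
  to store the next feedback.\<close>

lemma hist_append: "hist as \<omega> @ [(J, v)] = hist (as @ [J]) (fun_upd \<omega> (length as) v)"
proof -
  have "map (fun_upd \<omega> (length as) v) [0..<length as] = map \<omega> [0..<length as]" by simp
  thus ?thesis by simp
qed

lemma hist_surj: "\<exists>\<omega>. h = hist (map fst h) \<omega>"
  by (rule exI[of _ "\<lambda>i. snd (h ! i)"]) (auto intro!: nth_equalityI simp: prod_eq_iff)

text \<open>Strong induction on the length: the importance weights and thresholds inside the
  cumulative loss are built from the distributions of all shorter prefixes.\<close>

lemma htinf_hist_measurable:
  assumes "K \<ge> 1"
  shows "(\<lambda>\<omega>. pmf (htinf K \<sigma> (hist as \<omega>)) i) \<in> borel_measurable noise_space"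
proof (induction "length as" arbitrary: as i rule: less_induct)
  case less
  show ?case
  proof (cases "i \<in> {1..K}")
    case False
    have "pmf (htinf K \<sigma> (hist as \<omega>)) i = 0" for \<omega>
      using htinf_action_dists[OF assms] False
      by (rule pmf_outside_action_dists)
    thus ?thesis by simp
  next
    case True
    have cum: "cum_loss K \<sigma> (hist as \<omega>) j =
      (\<Sum>s<length as. if \<bar>\<omega> s\<bar> > (1 - 2 powr (- 1 / 3)) * \<sigma> * sqrt (real (s + 1)) *
            sqrt (pmf (htinf K \<sigma> (hist (take s as) \<omega>)) (as ! s)) then 0
          else if j = as ! s then \<omega> s / pmf (htinf K \<sigma> (hist (take s as) \<omega>)) j else 0)" for \<omega> j
      unfolding cum_loss_def
    proof (rule sum.cong)
      fix s assume "s \<in> {..<length as}"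
      hence s: "s < length as" by simp
      hence nth: "hist as \<omega> ! s = (as ! s, \<omega> s)" by simp
      have take: "take s (hist as \<omega>) = hist (take s as) \<omega>" using s by (intro take_hist) simp
      show "htinf_estimate \<sigma> (s + 1) (htinf K \<sigma> (take s (hist as \<omega>))) (hist as \<omega> ! s) j =
        (if \<bar>\<omega> s\<bar> > (1 - 2 powr (- 1 / 3)) * \<sigma> * sqrt (real (s + 1)) *
            sqrt (pmf (htinf K \<sigma> (hist (take s as) \<omega>)) (as ! s)) then 0
          else if j = as ! s then \<omega> s / pmf (htinf K \<sigma> (hist (take s as) \<omega>)) j else 0)"
        unfolding nth take htinf_estimate_def htinf_threshold_def by (simp only: prod.case)
    qed simp
    have [measurable]: "(\<lambda>\<omega>. cum_loss K \<sigma> (hist as \<omega>) j) \<in> borel_measurable noise_space" for j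
      unfolding cum
    proof (rule borel_measurable_sum)
      fix s assume "s \<in> {..<length as}"
      hence [measurable]: "(\<lambda>\<omega>. pmf (htinf K \<sigma> (hist (take s as) \<omega>)) k) \<in> borel_measurable noise_space" for k
        using less[of "take s as"] by simp
      show "(\<lambda>\<omega>. if \<bar>\<omega> s\<bar> > (1 - 2 powr (- 1 / 3)) * \<sigma> * sqrt (real (s + 1)) *
            sqrt (pmf (htinf K \<sigma> (hist (take s as) \<omega>)) (as ! s)) then 0
          else if j = as ! s then \<omega> s / pmf (htinf K \<sigma> (hist (take s as) \<omega>)) j else 0)
          \<in> borel_measurable noise_space" by measurable
    qed
    show ?thesis
    proof (rule tsallis_weights_measurable[where l = "\<lambda>j \<omega>. htinf_rate \<sigma> (length as + 1) * cum_loss K \<sigma> (hist as \<omega>) j"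
          and q = "\<lambda>j \<omega>. pmf (htinf K \<sigma> (hist as \<omega>)) j", OF _ _ _ True])
      fix \<omega>
      show "\<exists>c. \<forall>i\<in>{1..K}. htinf_rate \<sigma> (length as + 1) * cum_loss K \<sigma> (hist as \<omega>) i + c > 0 \<and>
              pmf (htinf K \<sigma> (hist as \<omega>)) i =
              1 / (htinf_rate \<sigma> (length as + 1) * cum_loss K \<sigma> (hist as \<omega>) i + c)\<^sup>2"
        using htinf_normaliser[OF assms, of \<sigma> "hist as \<omega>"] by simp
      show "(\<Sum>i=1..K. pmf (htinf K \<sigma> (hist as \<omega>)) i) = 1"
        by (rule sum_pmf_action_dists[OF htinf_action_dists[OF assms]])
    qed measurable
  qed
qed

subsection \<open>The law of the conversion\<close>

definition batch_mean :: "nat \<Rightarrow> (nat \<Rightarrow> nat \<Rightarrow> real) \<Rightarrow> nat \<Rightarrow> nat \<Rightarrow> real" where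
  "batch_mean \<tau> L s J = (1 / real \<tau>) * (\<Sum>r=s+1..s+\<tau>. L r J)"

text \<open>These two properties are all that the law of the conversion and its privacy use of the
  bandit algorithm. Properties specific to HTINF enter with the regret.\<close>

locale measurable_bandit =
  fixes K :: nat and B :: bandit_alg
  assumes set_pmf_B: "set_pmf (B h) \<subseteq> {1..K}"
    and pmf_B_measurable: "(\<lambda>\<omega>. pmf (B (hist as \<omega>)) i) \<in> borel_measurable noise_space"
begin

lemma B_kernel_measurable:
  "(\<lambda>\<omega>. measure_pmf (B (hist as \<omega>))) \<in> noise_space \<rightarrow>\<^sub>M subprob_algebra (count_space UNIV)"
proof (rule measurable_subprob_algebra)
  fix A :: "nat set"
  \<comment> \<open>The support lies in a finite set that does not depend on the history, so
    measurability of the kernel reduces to that of finitely many point masses.\<close>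
  have "emeasure (measure_pmf (B h)) A = (\<Sum>i\<in>A \<inter> {1..K}. ennreal (pmf (B h) i))" for h
  proof -
    have "emeasure (measure_pmf (B h)) A = emeasure (measure_pmf (B h)) (A \<inter> {1..K})"
      using set_pmf_B[of h] by (intro emeasure_eq_AE) (auto simp: AE_measure_pmf_iff)
    thus ?thesis by (simp add: emeasure_measure_pmf_finite)
  qed
  thus "(\<lambda>\<omega>. emeasure (measure_pmf (B (hist as \<omega>))) A) \<in> borel_measurable noise_space"
    using pmf_B_measurable by simp
qed (auto intro: prob_space_imp_subprob_space measure_pmf.prob_space_axioms)

end

locale measurable_conversion = measurable_bandit +
  fixes \<tau> :: nat and \<epsilon> :: real
  assumes \<tau>_pos: "\<tau> \<ge> 1" and \<epsilon>_pos: "\<epsilon> > 0"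
begin

abbreviation conv :: "(nat \<Rightarrow> nat \<Rightarrow> real) \<Rightarrow> nat \<Rightarrow> (nat \<times> real) list \<Rightarrow> nat \<Rightarrow> nat list measure" where
  "conv L s h n \<equiv> conversion_from B \<tau> \<epsilon> L s h n"

abbreviation noise :: "real measure" where
  "noise \<equiv> laplace (1 / (real \<tau> * \<epsilon>))"

lemma noise_scale_pos: "1 / (real \<tau> * \<epsilon>) > 0"
  using \<tau>_pos \<epsilon>_pos by simp

lemma noise_subprob: "noise \<in> space (subprob_algebra borel)"
  using prob_space_laplace[OF noise_scale_pos]
  by (simp add: space_subprob_algebra prob_space_imp_subprob_space)

lemma append_kernel:
  "(\<lambda>I. return (count_space UNIV) (xs @ I)) \<in> count_space UNIV \<rightarrow>\<^sub>M subprob_algebra (count_space UNIV)"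
  by (rule measurable_compose[OF _ return_measurable]) simp

lemma conversion_short:
  "0 < n \<Longrightarrow> n < \<tau> \<Longrightarrow>
     conv L s h n = measure_pmf (B h) \<bind> (\<lambda>J. return (count_space UNIV) (replicate n J))"
  by (subst conversion_from.simps) simp

lemma conversion_batch:
  assumes "n \<ge> \<tau>"
  shows "conv L s h n = measure_pmf (B h) \<bind> (\<lambda>J. noise \<bind> (\<lambda>Z.
    conv L (s + \<tau>) (h @ [(J, batch_mean \<tau> L s J + Z)]) (n - \<tau>) \<bind>
      (\<lambda>I. return (count_space UNIV) (replicate \<tau> J @ I))))"
  using assms \<tau>_pos by (subst conversion_from.simps) (simp add: batch_mean_def)

text \<open>Induction on the remaining rounds. The continuation after a batch is the same kernel for
  the longer action list \<open>as @ [J]\<close>, evaluated at \<omega> with one coordinate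
  overwritten by the noisy mean, which is jointly measurable in \<omega> and Z.\<close>

lemma conversion_kernel_measurable:
  "(\<lambda>\<omega>. conv L s (hist as \<omega>) n) \<in> noise_space \<rightarrow>\<^sub>M subprob_algebra (count_space UNIV)"
proof (induction n arbitrary: s as rule: less_induct)
  case (less n)
  consider "n = 0" | "0 < n" "n < \<tau>" | "n \<ge> \<tau>" by linarith
  thus ?case
  proof cases
    case 1
    thus ?thesis
      by (subst conversion_from.simps) (simp add: space_subprob_algebra prob_space_imp_subprob_space prob_space_return)
  next
    case 2
    show ?thesis unfolding conversion_short[OF 2]
      by (rule measurable_bind2[OF B_kernel_measurable])
         (rule measurable_compose[OF _ return_measurable], simp)
  next
    case 3
    have step: "(\<lambda>\<omega>. noise \<bind> (\<lambda>Z.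
        conv L (s + \<tau>) (hist as \<omega> @ [(J, batch_mean \<tau> L s J + Z)]) (n - \<tau>) \<bind>
          (\<lambda>I. return (count_space UNIV) (replicate \<tau> J @ I))))
        \<in> noise_space \<rightarrow>\<^sub>M subprob_algebra (count_space UNIV)" for J
    proof (rule measurable_bind')
      show "(\<lambda>\<omega>. noise) \<in> noise_space \<rightarrow>\<^sub>M subprob_algebra borel"
        using noise_subprob by (rule measurable_const)
      have upd: "(\<lambda>(\<omega>, Z). fun_upd \<omega> (length as) (batch_mean \<tau> L s J + Z)) \<in> noise_space \<Otimes>\<^sub>M borel \<rightarrow>\<^sub>M noise_space"
      proof -
        have "(\<lambda>x. fst x) \<in> noise_space \<Otimes>\<^sub>M (borel :: real measure) \<rightarrow>\<^sub>M noise_space" by simp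
        hence [measurable]: "(\<lambda>x. fst x i) \<in> borel_measurable (noise_space \<Otimes>\<^sub>M (borel :: real measure))" for i
          by (rule measurable_compose) simp
        have "(\<lambda>x i. fun_upd (fst x) (length as) (batch_mean \<tau> L s J + snd x) i)
          \<in> noise_space \<Otimes>\<^sub>M (borel :: real measure) \<rightarrow>\<^sub>M noise_space"
          by (rule measurable_PiM_single') (auto simp: fun_upd_def)
        thus ?thesis by (simp add: split_beta' fun_upd_def)
      qed
      have "(\<lambda>\<omega>. conv L (s + \<tau>) (hist (as @ [J]) \<omega>) (n - \<tau>))
          \<in> noise_space \<rightarrow>\<^sub>M subprob_algebra (count_space UNIV)"
        using \<tau>_pos 3 by (intro less) auto
      from measurable_bind2[OF measurable_compose[OF upd this] append_kernel[of "replicate \<tau> J"]]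
      show "(\<lambda>(\<omega>, Z). conv L (s + \<tau>) (hist as \<omega> @ [(J, batch_mean \<tau> L s J + Z)]) (n - \<tau>) \<bind>
          (\<lambda>I. return (count_space UNIV) (replicate \<tau> J @ I)))
          \<in> noise_space \<Otimes>\<^sub>M borel \<rightarrow>\<^sub>M subprob_algebra (count_space UNIV)"
        unfolding hist_append by (simp add: split_beta')
    qed
    show ?thesis unfolding conversion_batch[OF 3]
    proof (rule measurable_bind'[OF B_kernel_measurable])
      show "(\<lambda>(\<omega>, J). noise \<bind> (\<lambda>Z.
        conv L (s + \<tau>) (hist as \<omega> @ [(J, batch_mean \<tau> L s J + Z)]) (n - \<tau>) \<bind>
          (\<lambda>I. return (count_space UNIV) (replicate \<tau> J @ I))))
        \<in> noise_space \<Otimes>\<^sub>M count_space UNIV \<rightarrow>\<^sub>M subprob_algebra (count_space UNIV)"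
        unfolding split_beta'
        \<comment> \<open>The action ranges over a countable discrete space, so measurability for
          each fixed action gives joint measurability.\<close>
        by (rule measurable_compose_countable[where g = snd, OF measurable_compose[OF measurable_fst step]]) simp
    qed
  qed
qed

lemma conversion_update_measurable:
  "(\<lambda>Z. conv L s (h @ [(J, c + Z)]) n) \<in> borel \<rightarrow>\<^sub>M subprob_algebra (count_space UNIV)"
proof -
  obtain \<omega> where \<omega>: "h = hist (map fst h) \<omega>" using hist_surj by blast
  have "(\<lambda>Z i. fun_upd \<omega> (length (map fst h)) (c + Z) i) \<in> borel \<rightarrow>\<^sub>M noise_space"
    by (rule measurable_PiM_single') (auto simp: fun_upd_def)
  from measurable_compose[OF this conversion_kernel_measurable[of L s "map fst h @ [J]" n]]
  show ?thesis by (subst \<omega>, unfold hist_append)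
qed

lemma conversion_subprob: "conv L s h n \<in> space (subprob_algebra (count_space UNIV))"
proof -
  obtain \<omega> where \<omega>: "h = hist (map fst h) \<omega>" using hist_surj by blast
  show ?thesis
    by (subst \<omega>, rule measurable_space[OF conversion_kernel_measurable]) (simp add: space_PiM)
qed

lemma nn_integral_conversion_short:
  assumes "0 < n" "n < \<tau>"
  shows "(\<integral>\<^sup>+I. f I \<partial>conv L s h n) = (\<integral>\<^sup>+J. f (replicate n J) \<partial>measure_pmf (B h))"
  unfolding conversion_short[OF assms]
  by (subst nn_integral_bind[where B = "count_space UNIV"])
     (auto simp: nn_integral_return space_subprob_algebra prob_space_imp_subprob_space prob_space_return)

text \<open>The recursive form of the law through which both the privacy and the regret induction
  peel off a batch. The work lies in checking that each nested \<open>bind\<close> has a measurable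
  kernel.\<close>

lemma nn_integral_conversion_batch:
  assumes "n \<ge> \<tau>"
  shows "(\<integral>\<^sup>+I. f I \<partial>conv L s h n) = (\<integral>\<^sup>+J. \<integral>\<^sup>+Z. \<integral>\<^sup>+I. f (replicate \<tau> J @ I)
    \<partial>conv L (s + \<tau>) (h @ [(J, batch_mean \<tau> L s J + Z)]) (n - \<tau>) \<partial>noise \<partial>measure_pmf (B h))"
proof -
  have kernel: "(\<lambda>Z. conv L (s + \<tau>) (h @ [(J, batch_mean \<tau> L s J + Z)]) (n - \<tau>) \<bind>
      (\<lambda>I. return (count_space UNIV) (replicate \<tau> J @ I))) \<in> noise \<rightarrow>\<^sub>M subprob_algebra (count_space UNIV)" for J
    by (rule measurable_bind2[OF _ append_kernel])
       (simp cong: measurable_cong_sets add: conversion_update_measurable)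
  have inner: "(\<lambda>J. noise \<bind> (\<lambda>Z. conv L (s + \<tau>) (h @ [(J, batch_mean \<tau> L s J + Z)]) (n - \<tau>) \<bind>
      (\<lambda>I. return (count_space UNIV) (replicate \<tau> J @ I))))
      \<in> measure_pmf (B h) \<rightarrow>\<^sub>M subprob_algebra (count_space UNIV)"
  proof -
    have "noise \<bind> (\<lambda>Z. conv L (s + \<tau>) (h @ [(J, batch_mean \<tau> L s J + Z)]) (n - \<tau>) \<bind>
      (\<lambda>I. return (count_space UNIV) (replicate \<tau> J @ I))) \<in> space (subprob_algebra (count_space UNIV))" for J
    proof -
      have "noise \<in> space (subprob_algebra noise)"
        using noise_subprob by (simp cong: subprob_algebra_cong)
      \<comment> \<open>The bind is viewed as a kernel on a one-point space, so that measurability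
        of kernel composition shows it to be a subprobability.\<close>
      from measurable_space[OF measurable_bind2[OF measurable_const[OF this, of "count_space {()}"] kernel]]
      show ?thesis by simp
    qed
    thus ?thesis by simp
  qed
  have "(\<integral>\<^sup>+I. f I \<partial>(conv L (s + \<tau>) h' (n - \<tau>) \<bind> (\<lambda>I. return (count_space UNIV) (replicate \<tau> J @ I)))) =
     (\<integral>\<^sup>+I. f (replicate \<tau> J @ I) \<partial>conv L (s + \<tau>) h' (n - \<tau>))" for h' J
  proof -
    have sets: "sets (conv L (s + \<tau>) h' (n - \<tau>)) = sets (count_space UNIV)"
      using conversion_subprob by (simp add: space_subprob_algebra)
    show ?thesis
      by (subst nn_integral_bind[where B = "count_space UNIV"])
         (use append_kernel in \<open>simp_all add: nn_integral_return measurable_cong_sets[OF sets refl]\<close>)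
  qed
  thus ?thesis
    unfolding conversion_batch[OF assms]
    by (simp add: nn_integral_bind[OF _ inner] nn_integral_bind[OF _ kernel])
qed

subsection \<open>Privacy\<close>

lemma feedback_integral_measurable:
  "(\<lambda>v. \<integral>\<^sup>+I. f I \<partial>conv L s (h @ [(J, v)]) n) \<in> borel_measurable borel"
  using measurable_compose[OF conversion_update_measurable[of L s h J 0 n]
    nn_integral_measurable_subprob_algebra[of f]] by simp

text \<open>An incomplete batch yields no feedback, so its actions depend on the history
  alone.\<close>

lemma conversion_short_cong:
  assumes "n < \<tau>"
  shows "conv L s h n = conv L' s h n"
proof (cases "n = 0")
  case True
  thus ?thesis by (simp add: conversion_from.simps[of B \<tau> \<epsilon> _ s h 0])
next
  case False
  thus ?thesis using assms by (simp add: conversion_short)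
qed

lemma batch_mean_cong:
  "(\<And>r. r \<in> {s+1..s+\<tau>} \<Longrightarrow> L r J = L' r J) \<Longrightarrow> batch_mean \<tau> L s J = batch_mean \<tau> L' s J"
  unfolding batch_mean_def by (intro arg_cong2[where f = "(*)"] refl sum.cong) auto

text \<open>Once the batch with the changed loss is over, equal histories have the same future; this
  is the post-processing part of privacy. Only actions in {1..K} are compared, which suffices
  because the bandit draws no others.\<close>

lemma nn_integral_conversion_cong:
  assumes "\<And>r i. r \<in> {s+1..s+n} \<Longrightarrow> i \<in> {1..K} \<Longrightarrow> L r i = L' r i"
  shows "(\<integral>\<^sup>+I. f I \<partial>conv L s h n) = (\<integral>\<^sup>+I. f I \<partial>conv L' s h n)"
  using assms
proof (induction n arbitrary: s h f rule: less_induct)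
  case (less n)
  show ?case
  proof (cases "n < \<tau>")
    case True
    thus ?thesis using conversion_short_cong[of n L s h L'] by simp
  next
    case False
    hence n: "n \<ge> \<tau>" by simp
    show ?thesis unfolding nn_integral_conversion_batch[OF n]
    proof (rule nn_integral_cong_AE, unfold AE_measure_pmf_iff, intro ballI nn_integral_cong)
      fix J Z assume "J \<in> set_pmf (B h)"
      hence J: "J \<in> {1..K}" using set_pmf_B by blast
      have "batch_mean \<tau> L s J = batch_mean \<tau> L' s J"
        using less.prems[OF _ J] n by (intro batch_mean_cong) auto
      moreover have "(\<integral>\<^sup>+I. f (replicate \<tau> J @ I) \<partial>conv L (s + \<tau>) h' (n - \<tau>)) =
          (\<integral>\<^sup>+I. f (replicate \<tau> J @ I) \<partial>conv L' (s + \<tau>) h' (n - \<tau>))" for h'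
      proof (rule less.IH)
        show "n - \<tau> < n" using n \<tau>_pos by simp
        show "L r i = L' r i" if "r \<in> {s + \<tau> + 1..s + \<tau> + (n - \<tau>)}" "i \<in> {1..K}" for r i
          using that n by (intro less.prems) auto
      qed
      ultimately show "(\<integral>\<^sup>+I. f (replicate \<tau> J @ I)
            \<partial>conv L (s + \<tau>) (h @ [(J, batch_mean \<tau> L s J + Z)]) (n - \<tau>)) =
          (\<integral>\<^sup>+I. f (replicate \<tau> J @ I)
            \<partial>conv L' (s + \<tau>) (h @ [(J, batch_mean \<tau> L' s J + Z)]) (n - \<tau>))" by simp
    qed
  qed
qed

lemma batch_mean_sensitivity:
  assumes "\<And>r. r \<in> {s+1..s+\<tau>} \<Longrightarrow> r \<noteq> t \<Longrightarrow> L r J = L' r J"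
    and "t \<in> {s+1..s+\<tau>}" "L t J \<in> {0..1}" "L' t J \<in> {0..1}"
  shows "\<bar>batch_mean \<tau> L s J - batch_mean \<tau> L' s J\<bar> \<le> 1 / real \<tau>"
proof -
  have "(\<Sum>r=s+1..s+\<tau>. L r J) - (\<Sum>r=s+1..s+\<tau>. L' r J) = (\<Sum>r=s+1..s+\<tau>. L r J - L' r J)"
    by (simp add: sum_subtractf)
  also have "\<dots> = (\<Sum>r\<in>{t}. L r J - L' r J)"
    using assms(1,2) by (intro sum.mono_neutral_right) auto
  finally have "batch_mean \<tau> L s J - batch_mean \<tau> L' s J = (1 / real \<tau>) * (L t J - L' t J)"
    unfolding batch_mean_def by (simp flip: diff_divide_distrib)
  moreover have "\<bar>L t J - L' t J\<bar> \<le> 1" using assms(3,4) by auto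
  ultimately show ?thesis using \<tau>_pos by (simp add: abs_mult divide_right_mono)
qed

text \<open>The action of a batch is drawn before any of its losses is used, so given
  \<open>h\<close> it has the same law on both sides. The factor exp \<epsilon> is paid in the batch
  containing \<open>t\<close>, after which the futures agree; any other batch feeds the same mean
  and passes the factor on from the induction hypothesis. Quantifying over all \<open>f\<close> lets
  the prefix of played actions be absorbed into \<open>f\<close>.\<close>

lemma nn_integral_conversion_private:
  assumes "\<And>r i. r \<in> {s+1..s+n} \<Longrightarrow> r \<noteq> t \<Longrightarrow> i \<in> {1..K} \<Longrightarrow> L r i = L' r i"
    and t: "\<And>i. i \<in> {1..K} \<Longrightarrow> L t i \<in> {0..1}" "\<And>i. i \<in> {1..K} \<Longrightarrow> L' t i \<in> {0..1}"
  shows "(\<integral>\<^sup>+I. f I \<partial>conv L s h n) \<le> ennreal (exp \<epsilon>) * (\<integral>\<^sup>+I. f I \<partial>conv L' s h n)"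
  using assms(1)
proof (induction n arbitrary: s h f rule: less_induct)
  case (less n)
  have le: "x \<le> ennreal (exp \<epsilon>) * x" for x :: ennreal
  proof -
    have "ennreal 1 \<le> ennreal (exp \<epsilon>)" using \<epsilon>_pos by (intro ennreal_leI) simp
    from mult_right_mono[OF this, of x] show ?thesis by simp
  qed
  show ?case
  proof (cases "n < \<tau>")
    case True
    thus ?thesis using conversion_short_cong[of n L s h L'] le by simp
  next
    case False
    hence n: "n \<ge> \<tau>" by simp
    have "(\<integral>\<^sup>+Z. \<integral>\<^sup>+I. f (replicate \<tau> J @ I)
            \<partial>conv L (s + \<tau>) (h @ [(J, batch_mean \<tau> L s J + Z)]) (n - \<tau>) \<partial>noise) \<le> ennreal (exp \<epsilon>) *
          (\<integral>\<^sup>+Z. \<integral>\<^sup>+I. f (replicate \<tau> J @ I)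
            \<partial>conv L' (s + \<tau>) (h @ [(J, batch_mean \<tau> L' s J + Z)]) (n - \<tau>) \<partial>noise)"
      (is "?l \<le> ?r") if "J \<in> set_pmf (B h)" for J
    proof -
      from that have J: "J \<in> {1..K}" using set_pmf_B by blast
      define g where "g L v = (\<integral>\<^sup>+I. f (replicate \<tau> J @ I) \<partial>conv L (s + \<tau>) (h @ [(J, v)]) (n - \<tau>))" for L v
      have [measurable]: "g L \<in> borel_measurable borel" for L
        unfolding g_def by (rule feedback_integral_measurable)
      show "?l \<le> ?r"
      proof (cases "t \<in> {s+1..s+\<tau>}")
        case True
        \<comment> \<open>The continuation starts after round \<open>t\<close>, so a common fed
          value leads to a common law.\<close>
        have "g L v = g L' v" for v
          unfolding g_def using less.prems n True by (intro nn_integral_conversion_cong) auto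
        moreover have "\<bar>batch_mean \<tau> L s J - batch_mean \<tau> L' s J\<bar> \<le> 1 / real \<tau>"
          using less.prems[OF _ _ J] n True t[OF J] by (intro batch_mean_sensitivity[of s t]) auto
        ultimately show ?thesis
          using laplace_shift_le[OF noise_scale_pos, of "g L'" "batch_mean \<tau> L s J" "batch_mean \<tau> L' s J" \<epsilon>] \<epsilon>_pos
          by (simp add: g_def)
      next
        case False
        have "batch_mean \<tau> L s J = batch_mean \<tau> L' s J"
          using less.prems[OF _ _ J] n False by (intro batch_mean_cong) auto
        moreover have "g L v \<le> ennreal (exp \<epsilon>) * g L' v" for v
          unfolding g_def
        proof (rule less.IH)
          show "n - \<tau> < n" using n \<tau>_pos by simp
          show "L r i = L' r i" if "r \<in> {s + \<tau> + 1..s + \<tau> + (n - \<tau>)}" "r \<noteq> t" "i \<in> {1..K}" for r i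
            using that n by (intro less.prems) auto
        qed
        ultimately have "?l \<le> (\<integral>\<^sup>+Z. ennreal (exp \<epsilon>) * g L' (batch_mean \<tau> L' s J + Z) \<partial>noise)"
          by (intro nn_integral_mono) (simp add: g_def)
        also have "\<dots> = ?r" unfolding g_def[symmetric] by (rule nn_integral_cmult) simp
        finally show ?thesis .
      qed
    qed
    hence "(\<integral>\<^sup>+I. f I \<partial>conv L s h n) \<le> (\<integral>\<^sup>+J. ennreal (exp \<epsilon>) * (\<integral>\<^sup>+Z. \<integral>\<^sup>+I. f (replicate \<tau> J @ I)
            \<partial>conv L' (s + \<tau>) (h @ [(J, batch_mean \<tau> L' s J + Z)]) (n - \<tau>) \<partial>noise) \<partial>measure_pmf (B h))"
      unfolding nn_integral_conversion_batch[OF n]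
      by (intro nn_integral_mono_AE) (simp add: AE_measure_pmf_iff)
    also have "\<dots> = ennreal (exp \<epsilon>) * (\<integral>\<^sup>+I. f I \<partial>conv L' s h n)"
      unfolding nn_integral_conversion_batch[OF n] by (rule nn_integral_cmult) simp
    finally show ?thesis .
  qed
qed

lemma private_conversion_differentially_private:
  "differentially_private K \<epsilon> (private_conversion B \<tau> \<epsilon>)"
  unfolding differentially_private_def
proof (intro allI ballI impI)
  fix T L L' and E :: "nat list set"
  assume L: "L \<in> loss_seqs K T" "L' \<in> loss_seqs K T"
    and "\<exists>!t. t \<in> {1..T} \<and> (\<exists>i\<in>{1..K}. L t i \<noteq> L' t i)"
  then obtain t where t: "t \<in> {1..T}"
    and uniq: "\<And>r i. r \<in> {1..T} \<Longrightarrow> i \<in> {1..K} \<Longrightarrow> L r i \<noteq> L' r i \<Longrightarrow> r = t" by blast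
  have sets: "sets (conv L 0 [] T) = UNIV" for L
    using conversion_subprob[of L 0 "[]" T] by (simp add: space_subprob_algebra)
  have fin: "finite_measure (conv L 0 [] T)" for L
    using conversion_subprob[of L 0 "[]" T] by (simp add: space_subprob_algebra subprob_space_def)
  have "(\<integral>\<^sup>+I. indicator E I \<partial>conv L 0 [] T) \<le> ennreal (exp \<epsilon>) * (\<integral>\<^sup>+I. indicator E I \<partial>conv L' 0 [] T)"
  proof (rule nn_integral_conversion_private[where t = t])
    show "L r i = L' r i" if "r \<in> {0 + 1..0 + T}" "r \<noteq> t" "i \<in> {1..K}" for r i
      using uniq[of r i] that by fastforce
    show "L t i \<in> {0..1}" "L' t i \<in> {0..1}" if "i \<in> {1..K}" for i
      using L t that unfolding loss_seqs_def by blast+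
  qed
  hence "emeasure (conv L 0 [] T) E \<le> ennreal (exp \<epsilon>) * emeasure (conv L' 0 [] T) E"
    by (simp add: sets)
  thus "measure (private_conversion B \<tau> \<epsilon> T L) E \<le> exp \<epsilon> * measure (private_conversion B \<tau> \<epsilon> T L') E"
    unfolding private_conversion_def
    by (simp add: finite_measure.emeasure_eq_measure[OF fin] flip: ennreal_mult')
qed

end

subsection \<open>One step of HTINF\<close>

text \<open>Cauchy-Schwarz. This is the source of sqrt K in the regularisation, stability and
  skipping terms alike.\<close>

lemma sum_sqrt_pmf_le:
  assumes "p \<in> action_dists K"
  shows "(\<Sum>i=1..K. sqrt (pmf p i)) \<le> sqrt (real K)"
proof (rule real_le_rsqrt)
  have "(\<Sum>i=1..K. sqrt (pmf p i))\<^sup>2 \<le> (\<Sum>i=1..K. (sqrt (pmf p i))\<^sup>2) * card {1..K}"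
    by (rule sum_squared_le_sum_of_squares)
  also have "\<dots> = real K" using sum_pmf_action_dists[OF assms] by simp
  finally show "(\<Sum>i=1..K. sqrt (pmf p i))\<^sup>2 \<le> real K" .
qed

abbreviation skip_const :: real where
  "skip_const \<equiv> 2 powr (- 1 / 3)"

text \<open>The cube of \<open>skip_const\<close> is 1 / 2, which is less than (4 / 5)^3 = 64 / 125.
  The bounds give the factors 2 and 5 for the reciprocals of \<open>skip_const\<close> and
  \<open>1 - skip_const\<close>.\<close>

lemma skip_const_bounds: "1 / 2 \<le> skip_const" "skip_const \<le> 4 / 5"
proof -
  have "skip_const ^ 3 = skip_const powr 3" by (rule powr_numeral[symmetric]) simp
  also have "\<dots> = 2 powr (- 1)" by (simp only: powr_powr) simp
  also have "\<dots> = 1 / 2" by (simp add: powr_minus_divide)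
  finally have eq: "skip_const ^ 3 = 1 / 2" .
  show "1 / 2 \<le> skip_const"
    using powr_mono[of "- 1" "- 1 / 3" 2] by (simp add: powr_minus_divide)
  show "skip_const \<le> 4 / 5"
  proof (rule ccontr)
    assume "\<not> skip_const \<le> 4 / 5"
    hence "(4 / 5 :: real) ^ 3 \<le> skip_const ^ 3" by (intro power_mono) auto
    thus False unfolding eq by (simp add: power3_eq_cube)
  qed
qed

text \<open>The reciprocal of the learning rate in round \<open>m + 1\<close>, i.e. after a history of length \<open>m\<close>.\<close>

definition reg_weight :: "real \<Rightarrow> nat \<Rightarrow> real" where
  "reg_weight \<sigma> m = \<sigma> * sqrt (real (m + 1))"

lemma reg_weight_pos: "\<sigma> > 0 \<Longrightarrow> reg_weight \<sigma> m > 0"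
  by (simp add: reg_weight_def)

lemma reg_weight_mono: "\<sigma> > 0 \<Longrightarrow> m \<le> n \<Longrightarrow> reg_weight \<sigma> m \<le> reg_weight \<sigma> n"
  by (simp add: reg_weight_def)

text \<open>The minimal objective divided by the learning rate: the weight sits on the regulariser
  and not on the losses, so that values of successive histories, whose rates differ, can be
  subtracted.\<close>

definition ftrl_value :: "nat \<Rightarrow> real \<Rightarrow> (nat \<times> real) list \<Rightarrow> real" where
  "ftrl_value K \<sigma> h = (\<Sum>i=1..K. cum_loss K \<sigma> h i * pmf (htinf K \<sigma> h) i)
     - reg_weight \<sigma> (length h) * (2 * (\<Sum>i=1..K. sqrt (pmf (htinf K \<sigma> h) i)))"

lemma htinf_pmf_pos:
  assumes "K \<ge> 1" "i \<in> {1..K}"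
  shows "pmf (htinf K \<sigma> h) i > 0"
proof -
  obtain c where "\<forall>i\<in>{1..K}. htinf_rate \<sigma> (length h + 1) * cum_loss K \<sigma> h i + c > 0 \<and>
      pmf (htinf K \<sigma> h) i = 1 / (htinf_rate \<sigma> (length h + 1) * cum_loss K \<sigma> h i + c)\<^sup>2"
    using htinf_normaliser[OF assms(1)] by blast
  from bspec[OF this assms(2)] show ?thesis by (metis zero_less_divide_1_iff zero_less_power)
qed

text \<open>The Bregman identity for the minimiser, multiplied by the reciprocal
  \<open>\<beta>\<close> of the learning rate. It is applied to a point mass, for the comparator,
  and to the next distribution of HTINF, for the step.\<close>

lemma htinf_objective_eq:
  fixes h :: "(nat \<times> real) list"
  assumes "K \<ge> 1" "\<sigma> > 0" "p \<in> action_dists K"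
  defines "x \<equiv> pmf (htinf K \<sigma> h)" and "\<beta> \<equiv> reg_weight \<sigma> (length h)"
  shows "(\<Sum>i=1..K. cum_loss K \<sigma> h i * pmf p i) - \<beta> * (2 * (\<Sum>i=1..K. sqrt (pmf p i))) =
         ftrl_value K \<sigma> h + \<beta> * (\<Sum>i=1..K. (sqrt (pmf p i) - sqrt (x i))\<^sup>2 / sqrt (x i))"
proof -
  define \<eta> where "\<eta> = htinf_rate \<sigma> (length h + 1)"
  have \<beta>\<eta>: "\<beta> * \<eta> = 1" using assms(2) by (simp add: \<beta>_def \<eta>_def reg_weight_def htinf_rate_def)
  obtain c where c: "\<And>i. i \<in> {1..K} \<Longrightarrow> \<eta> * cum_loss K \<sigma> h i + c > 0"
    "\<And>i. i \<in> {1..K} \<Longrightarrow> x i = 1 / (\<eta> * cum_loss K \<sigma> h i + c)\<^sup>2"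
    using htinf_normaliser[OF assms(1), of \<sigma> h] unfolding x_def \<eta>_def by blast
  have "(\<Sum>i=1..K. \<eta> * cum_loss K \<sigma> h i * pmf p i) - 2 * (\<Sum>i=1..K. sqrt (pmf p i)) =
        (\<Sum>i=1..K. \<eta> * cum_loss K \<sigma> h i * x i) - 2 * (\<Sum>i=1..K. sqrt (x i)) +
        (\<Sum>i=1..K. (sqrt (pmf p i) - sqrt (x i))\<^sup>2 / sqrt (x i))"
  proof (rule tsallis_objective_eq[where c = c])
    show "x i > 0" if "i \<in> {1..K}" for i unfolding x_def by (rule htinf_pmf_pos[OF assms(1) that])
    show "\<eta> * cum_loss K \<sigma> h i + c = 1 / sqrt (x i)" if "i \<in> {1..K}" for i
      using c(1)[OF that] c(2)[OF that] by (simp add: real_sqrt_divide)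
    show "sum x {1..K} = sum (pmf p) {1..K}"
      unfolding x_def by (simp only: sum_pmf_action_dists assms(3) htinf_action_dists[OF assms(1)])
  qed simp
  hence "\<beta> * ((\<Sum>i=1..K. \<eta> * cum_loss K \<sigma> h i * pmf p i) - 2 * (\<Sum>i=1..K. sqrt (pmf p i))) =
        \<beta> * ((\<Sum>i=1..K. \<eta> * cum_loss K \<sigma> h i * x i) - 2 * (\<Sum>i=1..K. sqrt (x i)) +
        (\<Sum>i=1..K. (sqrt (pmf p i) - sqrt (x i))\<^sup>2 / sqrt (x i)))" by simp
  moreover have "\<beta> * (\<Sum>i=1..K. \<eta> * cum_loss K \<sigma> h i * y i) = (\<Sum>i=1..K. cum_loss K \<sigma> h i * y i)" for y
    unfolding mult.assoc sum_distrib_left[of \<eta>, symmetric] using \<beta>\<eta> by (simp flip: mult.assoc)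
  ultimately show ?thesis
    unfolding ftrl_value_def x_def[symmetric] \<beta>_def[symmetric] by (simp only: right_diff_distrib distrib_left)
qed

lemma cum_loss_Nil [simp]: "cum_loss K \<sigma> [] i = 0"
  by (simp add: cum_loss_def)

lemma cum_loss_snoc:
  "cum_loss K \<sigma> (h @ [(J, v)]) i =
     cum_loss K \<sigma> h i + htinf_estimate \<sigma> (length h + 1) (htinf K \<sigma> h) (J, v) i"
  unfolding cum_loss_def by (simp add: nth_append)

lemma htinf_estimate_eq:
  "htinf_estimate \<sigma> t x (J, v) i = (if i = J then trunc (htinf_threshold \<sigma> t x J) v / pmf x J else 0)"
  by (simp add: htinf_estimate_def trunc_def)

text \<open>The point mass at \<open>i\<close> competes in the minimisation, and the regulariser
  only lowers its value. This makes the potential nonnegative.\<close>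

lemma ftrl_value_le_cum_loss:
  assumes "K \<ge> 1" "\<sigma> > 0" "i \<in> {1..K}"
  shows "ftrl_value K \<sigma> h \<le> cum_loss K \<sigma> h i"
proof -
  have dist: "return_pmf i \<in> action_dists K" using assms(3) by (simp add: action_dists_def)
  let ?x = "pmf (htinf K \<sigma> h)" and ?\<beta> = "reg_weight \<sigma> (length h)" and ?y = "pmf (return_pmf i)"
  have "ftrl_value K \<sigma> h \<le> ftrl_value K \<sigma> h + ?\<beta> * (\<Sum>j=1..K. (sqrt (?y j) - sqrt (?x j))\<^sup>2 / sqrt (?x j))"
    using reg_weight_pos[OF assms(2), of "length h"] by (simp add: sum_nonneg)
  also have "\<dots> = (\<Sum>j=1..K. cum_loss K \<sigma> h j * ?y j) - ?\<beta> * (2 * (\<Sum>j=1..K. sqrt (?y j)))"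
    by (rule htinf_objective_eq[OF assms(1,2) dist, symmetric])
  also have "\<dots> \<le> (\<Sum>j=1..K. cum_loss K \<sigma> h j * ?y j)"
    using reg_weight_pos[OF assms(2), of "length h"] by (simp add: sum_nonneg)
  also have "\<dots> = (\<Sum>j=1..K. if j = i then cum_loss K \<sigma> h j else 0)"
    by (intro sum.cong) (auto simp: pmf_return)
  also have "\<dots> = cum_loss K \<sigma> h i" using assms(3) by simp
  finally show ?thesis .
qed

lemma ftrl_value_Nil_ge:
  assumes "K \<ge> 1" "\<sigma> > 0"
  shows "- (2 * \<sigma> * sqrt (real K)) \<le> ftrl_value K \<sigma> []"
  using mult_left_mono[OF sum_sqrt_pmf_le[OF htinf_action_dists[OF assms(1), of \<sigma> "[]"]], of "2 * \<sigma>"] assms(2)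
  by (simp add: ftrl_value_def reg_weight_def)

text \<open>With \<open>a\<close> and \<open>b\<close> the square roots of the old and new weight of the drawn action, the left-hand
  side is the loss change minus the Bregman divergence; \<open>\<bar>w\<bar> \<le> (1 - \<theta>) \<beta> a\<close> is the skipping rule.\<close>

lemma tsallis_stability:
  fixes a b w \<beta> \<theta> :: real
  assumes "a > 0" "\<beta> > 0" "\<theta> > 0" "\<bar>w\<bar> \<le> (1 - \<theta>) * \<beta> * a"
  shows "w - w * (b\<^sup>2 / a\<^sup>2) - \<beta> * ((b - a)\<^sup>2 / a) \<le> w\<^sup>2 / (\<theta> * \<beta> * a)"
proof -
  define d where "d = b - a"
  have b: "b = a + d" by (simp add: d_def)
  \<comment> \<open>For negative w this second-order term is positive. The skipping rule lets a
    share 1 - \<theta> of the divergence pay for it.\<close>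
  have "- w * (d\<^sup>2 / a\<^sup>2) \<le> ((1 - \<theta>) * \<beta> * a) * (d\<^sup>2 / a\<^sup>2)"
    using assms(4) by (intro mult_right_mono) auto
  also have "\<dots> = (1 - \<theta>) * \<beta> * (d\<^sup>2 / a)" using assms(1) by (simp add: power2_eq_square)
  also have "\<dots> = \<beta> * (d\<^sup>2 / a) - \<theta> * \<beta> * (d\<^sup>2 / a)" by (simp only: left_diff_distrib mult_1)
  finally have 1: "- w * (d\<^sup>2 / a\<^sup>2) \<le> \<beta> * (d\<^sup>2 / a) - \<theta> * \<beta> * (d\<^sup>2 / a)" .
  \<comment> \<open>Completing the square: the remaining share \<theta> of the divergence absorbs
    the term linear in d.\<close>
  have "0 \<le> (w + \<theta> * \<beta> * d)\<^sup>2 / (\<theta> * \<beta> * a)" using assms by simp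
  also have "\<dots> = w\<^sup>2 / (\<theta> * \<beta> * a) + 2 * w * d / a + \<theta> * \<beta> * (d\<^sup>2 / a)"
    using assms by (simp add: field_simps power2_eq_square)
  finally have 2: "- (2 * w * d / a) - \<theta> * \<beta> * (d\<^sup>2 / a) \<le> w\<^sup>2 / (\<theta> * \<beta> * a)" by simp
  have "w - w * (b\<^sup>2 / a\<^sup>2) = - (2 * w * d / a) - w * (d\<^sup>2 / a\<^sup>2)"
    unfolding b using assms(1) by (simp add: field_simps power2_eq_square)
  moreover have "\<beta> * ((b - a)\<^sup>2 / a) = \<beta> * (d\<^sup>2 / a)" by (simp add: b)
  ultimately show ?thesis using 1 2 by linarith
qed

text \<open>The left-hand side is the estimated loss averaged over \<open>x\<close>, since the
  importance weight of \<open>J\<close> cancels. Old and new objective are compared at the new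
  distribution, where they differ by the new estimate and by the growth of
  \<open>\<beta>\<close>.\<close>

lemma ftrl_value_step:
  fixes h :: "(nat \<times> real) list"
  assumes K: "K \<ge> 1" and \<sigma>: "\<sigma> > 0" and J: "J \<in> {1..K}"
  defines "x \<equiv> htinf K \<sigma> h" and "\<beta> \<equiv> reg_weight \<sigma>" and "m \<equiv> length h"
  shows "trunc (htinf_threshold \<sigma> (m + 1) x J) v \<le>
    ftrl_value K \<sigma> (h @ [(J, v)]) - ftrl_value K \<sigma> h
    + v\<^sup>2 / (skip_const * \<beta> m * sqrt (pmf x J)) + 2 * sqrt (real K) * (\<beta> (m + 1) - \<beta> m)"
proof -
  define w where "w = trunc (htinf_threshold \<sigma> (m + 1) x J) v"
  define x' where "x' = htinf K \<sigma> (h @ [(J, v)])"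
  have x': "x' \<in> action_dists K" unfolding x'_def by (rule htinf_action_dists[OF K])
  have xpos: "pmf x i > 0" if "i \<in> {1..K}" for i unfolding x_def by (rule htinf_pmf_pos[OF K that])
  have \<beta>_pos: "\<beta> m > 0" unfolding \<beta>_def by (rule reg_weight_pos[OF \<sigma>])
  define D where "D = (\<Sum>i=1..K. (sqrt (pmf x' i) - sqrt (pmf x i))\<^sup>2 / sqrt (pmf x i))"
  define S where "S = (\<Sum>i=1..K. sqrt (pmf x' i))"
  have "(\<Sum>i=1..K. cum_loss K \<sigma> (h @ [(J, v)]) i * pmf x' i) =
     (\<Sum>i=1..K. cum_loss K \<sigma> h i * pmf x' i + (if i = J then w / pmf x J * pmf x' J else 0))"
    by (intro sum.cong) (auto simp: cum_loss_snoc htinf_estimate_eq w_def x_def m_def distrib_right)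
  also have "\<dots> = (\<Sum>i=1..K. cum_loss K \<sigma> h i * pmf x' i) + w / pmf x J * pmf x' J"
    using J by (simp add: sum.distrib)
  finally have "ftrl_value K \<sigma> (h @ [(J, v)]) =
     (\<Sum>i=1..K. cum_loss K \<sigma> h i * pmf x' i) + w / pmf x J * pmf x' J - \<beta> (m + 1) * (2 * S)"
    unfolding ftrl_value_def x'_def[symmetric] S_def \<beta>_def m_def by simp
  moreover have "(\<Sum>i=1..K. cum_loss K \<sigma> h i * pmf x' i) - \<beta> m * (2 * S) = ftrl_value K \<sigma> h + \<beta> m * D"
    unfolding D_def S_def \<beta>_def m_def x_def by (rule htinf_objective_eq[OF K \<sigma> x'])
  ultimately have value_eq: "ftrl_value K \<sigma> (h @ [(J, v)]) - ftrl_value K \<sigma> h =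
     \<beta> m * D + w / pmf x J * pmf x' J - 2 * S * (\<beta> (m + 1) - \<beta> m)" by (simp add: algebra_simps)
  \<comment> \<open>The estimate is nonzero at most at \<open>J\<close>, so the divergence in this
    coordinate alone has to control it.\<close>
  have D_ge: "(sqrt (pmf x' J) - sqrt (pmf x J))\<^sup>2 / sqrt (pmf x J) \<le> D"
    unfolding D_def by (rule member_le_sum) (use J in auto)
  have "\<bar>w\<bar> \<le> (1 - skip_const) * \<beta> m * sqrt (pmf x J)"
  proof -
    have "htinf_threshold \<sigma> (m + 1) x J = (1 - skip_const) * \<beta> m * sqrt (pmf x J)"
      by (simp add: htinf_threshold_def \<beta>_def reg_weight_def)
    moreover have "(1 - skip_const) * \<beta> m * sqrt (pmf x J) \<ge> 0"
      using skip_const_bounds \<beta>_pos by (intro mult_nonneg_nonneg) auto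
    ultimately show ?thesis by (auto simp: w_def trunc_def)
  qed
  from tsallis_stability[OF _ \<beta>_pos _ this, of "sqrt (pmf x' J)"] xpos[OF J]
  have "w - w * (pmf x' J / pmf x J) - \<beta> m * ((sqrt (pmf x' J) - sqrt (pmf x J))\<^sup>2 / sqrt (pmf x J))
      \<le> w\<^sup>2 / (skip_const * \<beta> m * sqrt (pmf x J))" by simp
  also have "\<dots> \<le> v\<^sup>2 / (skip_const * \<beta> m * sqrt (pmf x J))"
    using xpos[OF J] \<beta>_pos abs_trunc_le[of _ v]
    by (intro divide_right_mono) (auto simp: w_def abs_le_square_iff)
  finally have stab: "w \<le> w / pmf x J * pmf x' J
      + \<beta> m * ((sqrt (pmf x' J) - sqrt (pmf x J))\<^sup>2 / sqrt (pmf x J))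
      + v\<^sup>2 / (skip_const * \<beta> m * sqrt (pmf x J))" by simp
  have "S * (\<beta> (m + 1) - \<beta> m) \<le> sqrt (real K) * (\<beta> (m + 1) - \<beta> m)"
    unfolding S_def using sum_sqrt_pmf_le[OF x'] reg_weight_mono[OF \<sigma>, of m "m + 1"]
    by (intro mult_right_mono) (auto simp: \<beta>_def)
  moreover have "\<beta> m * ((sqrt (pmf x' J) - sqrt (pmf x J))\<^sup>2 / sqrt (pmf x J)) \<le> \<beta> m * D"
    using D_ge \<beta>_pos by (intro mult_left_mono) auto
  ultimately show ?thesis
    unfolding w_def[symmetric] using stab value_eq by linarith
qed

subsection \<open>Regret\<close>

text \<open>Concavity of sqrt, obtained by rationalising the differences; it lets the per-batch
  terms telescope.\<close>

lemma sqrt_diff_bounds: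
  fixes m :: nat
  shows "sqrt (real (m + 2)) - sqrt (real (m + 1)) \<le> sqrt (real (m + 1)) - sqrt (real m)"
    and "1 / sqrt (real (m + 1)) \<le> 2 * (sqrt (real (m + 1)) - sqrt (real m))"
proof -
  define a b c where "a = sqrt (real m)" and "b = sqrt (real (m + 1))" and "c = sqrt (real (m + 2))"
  have le: "0 \<le> a" "a \<le> b" "b \<le> c" "0 < b" by (auto simp: a_def b_def c_def)
  have "(b - a) * (b + a) = 1" "(c - b) * (c + b) = 1"
    unfolding a_def b_def c_def by (simp_all add: algebra_simps)
  hence ba: "b - a = 1 / (b + a)" and cb: "c - b = 1 / (c + b)"
    using le by (simp_all add: field_simps)
  have "1 / (c + b) \<le> 1 / (b + a)" using le by (intro divide_left_mono) auto
  thus "sqrt (real (m + 2)) - sqrt (real (m + 1)) \<le> sqrt (real (m + 1)) - sqrt (real m)"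
    using ba cb unfolding a_def b_def c_def by simp
  have "1 / b = 2 * (1 / (b + b))" by simp
  also have "\<dots> \<le> 2 * (1 / (b + a))" using le by (intro mult_left_mono divide_left_mono) auto
  finally show "1 / sqrt (real (m + 1)) \<le> 2 * (sqrt (real (m + 1)) - sqrt (real m))"
    using ba unfolding a_def b_def c_def by simp
qed

text \<open>The last assumption keeps the noise scale at most 1, as the second moment bound
  requires; the batch size \<lceil>1 / \<epsilon>\<rceil> guarantees it.\<close>

locale htinf_conversion =
  fixes K \<tau> :: nat and \<epsilon> :: real
  assumes K_pos: "K \<ge> 1" and \<tau>_pos: "\<tau> \<ge> 1" and \<epsilon>_pos: "\<epsilon> > 0" and \<tau>\<epsilon>: "real \<tau> * \<epsilon> \<ge> 1"

sublocale htinf_conversion \<subseteq> measurable_conversion K "htinf K (sqrt 6)" \<tau> \<epsilon>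
proof
  show "set_pmf (htinf K (sqrt 6) h) \<subseteq> {1..K}" for h
    using htinf_action_dists[OF K_pos] by (simp add: action_dists_def)
qed (use htinf_hist_measurable[OF K_pos] \<tau>_pos \<epsilon>_pos in simp_all)

context htinf_conversion
begin

abbreviation x :: "(nat \<times> real) list \<Rightarrow> nat pmf" where "x \<equiv> htinf K (sqrt 6)"
abbreviation \<beta> :: "nat \<Rightarrow> real" where "\<beta> \<equiv> reg_weight (sqrt 6)"
abbreviation r :: "(nat \<times> real) list \<Rightarrow> nat \<Rightarrow> real" where
  "r h J \<equiv> htinf_threshold (sqrt 6) (length h + 1) (x h) J"

lemma noise_scale_le_1: "1 / (real \<tau> * \<epsilon>) \<le> 1"
  using \<tau>\<epsilon> by simp

text \<open>Instantaneous regret of the drawn action \<open>J\<close> against \<open>i\<close>, minus its estimate from the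
  truncated feedback \<open>a J + z\<close>, plus the stability term.\<close>

definition excess :: "(nat \<times> real) list \<Rightarrow> (nat \<Rightarrow> real) \<Rightarrow> nat \<Rightarrow> nat \<Rightarrow> real \<Rightarrow> real" where
  "excess h a i J z = a J - trunc (r h J) (a J + z)
     + (if J = i then 1 / pmf (x h) i else 0) * trunc (r h i) (a i + z)
     + (a J + z)\<^sup>2 / (skip_const * \<beta> (length h) * sqrt (pmf (x h) J))"

text \<open>Averaging over \<open>J\<close> cancels the comparator's importance weight and leaves
  \<open>a i\<close>. The drawn action pays 6 * 5 for skipping and 6 * 2 for stability, together 42,
  over \<open>\<beta>\<close> times sqrt x_J; weighting by x_J turns this into sqrt x_J, which sums
  to at most sqrt K.\<close>

lemma excess_integral:
  assumes a: "\<And>J. J \<in> {1..K} \<Longrightarrow> a J \<in> {0..1}" and i: "i \<in> {1..K}"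
  shows "J \<in> {1..K} \<Longrightarrow> integrable noise (excess h a i J)"
    and "(\<Sum>J=1..K. pmf (x h) J * (\<integral>z. excess h a i J z \<partial>noise))
           \<le> a i + 42 * sqrt (real K) / \<beta> (length h)"
proof -
  interpret N: prob_space noise by (rule prob_space_laplace[OF noise_scale_pos])
  define b where "b = \<beta> (length h)"
  have b: "b > 0" unfolding b_def by (rule reg_weight_pos) simp
  have p: "pmf (x h) J > 0" if "J \<in> {1..K}" for J by (rule htinf_pmf_pos[OF K_pos that])
  have r_eq: "r h J = (1 - skip_const) * b * sqrt (pmf (x h) J)" for J
    by (simp add: htinf_threshold_def reg_weight_def b_def)
  have \<theta>: "1 / 2 \<le> skip_const" "1 / 5 \<le> 1 - skip_const" using skip_const_bounds by auto
  note sq = laplace_shifted_second_moment[OF noise_scale_pos noise_scale_le_1]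
  note tr = laplace_integrable_trunc[OF noise_scale_pos]
  have int_sq: "integrable noise (\<lambda>z. (a J + z)\<^sup>2)" if "J \<in> {1..K}" for J
    using sq(1)[of "a J"] a[OF that] by simp
  show "integrable noise (excess h a i J)" if "J \<in> {1..K}" for J
    unfolding excess_def[abs_def] using int_sq[OF that] tr by simp
  have J_bound: "(\<integral>z. excess h a i J z \<partial>noise)
      \<le> (if J = i then a i / pmf (x h) i else 0) + 42 / (b * sqrt (pmf (x h) J))" if J: "J \<in> {1..K}" for J
  proof -
    let ?s = "sqrt (pmf (x h) J)"
    have s: "?s > 0" using p[OF J] by simp
    have "(\<integral>z. excess h a i J z \<partial>noise) = (a J - (\<integral>z. trunc (r h J) (a J + z) \<partial>noise))
      + (if J = i then 1 / pmf (x h) i else 0) * (\<integral>z. trunc (r h i) (a i + z) \<partial>noise)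
      + (\<integral>z. (a J + z)\<^sup>2 \<partial>noise) / (skip_const * b * ?s)"
      unfolding excess_def b_def using int_sq[OF J] tr by (simp add: N.prob_space[simplified])
    also have "\<dots> \<le> 6 / r h J + (if J = i then 1 / pmf (x h) i else 0) * a i + 6 / (skip_const * b * ?s)"
    proof (intro add_mono mult_left_mono divide_right_mono)
      show "a J - (\<integral>z. trunc (r h J) (a J + z) \<partial>noise) \<le> 6 / r h J"
      proof (rule laplace_trunc_mean_ge[OF noise_scale_pos noise_scale_le_1])
        show "r h J > 0" unfolding r_eq using \<theta> b s by (intro mult_pos_pos) auto
      qed (use a[OF J] in auto)
      show "(\<integral>z. trunc (r h i) (a i + z) \<partial>noise) \<le> a i"
        using a[OF i] by (intro laplace_trunc_mean_le[OF noise_scale_pos]) auto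
      show "(\<integral>z. (a J + z)\<^sup>2 \<partial>noise) \<le> 6" using sq(2)[of "a J"] a[OF J] by simp
      show "0 \<le> skip_const * b * ?s" using \<theta> b s by simp
    qed simp
    also have "6 / r h J \<le> 30 / (b * ?s)"
    proof -
      have "1 / 5 * (b * ?s) \<le> (1 - skip_const) * (b * ?s)"
        using \<theta> b s by (intro mult_right_mono) auto
      hence "6 / ((1 - skip_const) * (b * ?s)) \<le> 6 / (1 / 5 * (b * ?s))" using b s by (intro frac_le) auto
      thus ?thesis unfolding r_eq by (simp add: mult.assoc)
    qed
    also have "6 / (skip_const * b * ?s) \<le> 12 / (b * ?s)"
    proof -
      have "1 / 2 * (b * ?s) \<le> skip_const * (b * ?s)"
        using \<theta> b s by (intro mult_right_mono) auto
      hence "6 / (skip_const * (b * ?s)) \<le> 6 / (1 / 2 * (b * ?s))" using b s by (intro frac_le) auto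
      thus ?thesis by (simp add: mult.assoc)
    qed
    finally show ?thesis by (auto simp flip: add_divide_distrib)
  qed
  have "(\<Sum>J=1..K. pmf (x h) J * (\<integral>z. excess h a i J z \<partial>noise)) \<le>
     (\<Sum>J=1..K. (if J = i then a i else 0) + 42 / b * sqrt (pmf (x h) J))"
  proof (rule sum_mono)
    fix J assume J: "J \<in> {1..K}"
    have "pmf (x h) J * (\<integral>z. excess h a i J z \<partial>noise) \<le>
        pmf (x h) J * ((if J = i then a i / pmf (x h) i else 0) + 42 / (b * sqrt (pmf (x h) J)))"
      using J_bound[OF J] by (rule mult_left_mono) simp
    also have "\<dots> = (if J = i then a i else 0) + 42 / b * (pmf (x h) J / sqrt (pmf (x h) J))"
      using p[OF J] p[OF i] by (simp add: distrib_left)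
    also have "pmf (x h) J / sqrt (pmf (x h) J) = sqrt (pmf (x h) J)" by (rule real_div_sqrt) simp
    finally show "pmf (x h) J * (\<integral>z. excess h a i J z \<partial>noise)
        \<le> (if J = i then a i else 0) + 42 / b * sqrt (pmf (x h) J)" .
  qed
  also have "\<dots> = a i + 42 / b * (\<Sum>J=1..K. sqrt (pmf (x h) J))"
    using i by (simp add: sum.distrib sum_distrib_left)
  also have "\<dots> \<le> a i + 42 / b * sqrt (real K)"
    using sum_sqrt_pmf_le[OF htinf_action_dists[OF K_pos]] b by (intro add_left_mono mult_left_mono) auto
  finally show "(\<Sum>J=1..K. pmf (x h) J * (\<integral>z. excess h a i J z \<partial>noise))
      \<le> a i + 42 * sqrt (real K) / \<beta> (length h)" by (simp add: b_def)
qed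

section \<open>Accounting of the losses batch by batch\<close>

definition loss_sum :: "(nat \<Rightarrow> nat \<Rightarrow> real) \<Rightarrow> nat \<Rightarrow> nat \<Rightarrow> nat list \<Rightarrow> real" where
  "loss_sum L s n I = (\<Sum>k<n. L (s + k + 1) (I ! k))"

lemma loss_sum_replicate: "loss_sum L s n (replicate n J) = (\<Sum>k<n. L (s + k + 1) J)"
  unfolding loss_sum_def by (intro sum.cong) auto

lemma sum_batch: "(\<Sum>k<\<tau>. L (s + k + 1) J) = real \<tau> * batch_mean \<tau> L s J"
proof -
  have "(\<Sum>k<\<tau>. L (s + k + 1) J) = (\<Sum>r=s+1..s+\<tau>. L r J)"
    by (rule sum.reindex_bij_witness[where i = "\<lambda>r. r - s - 1" and j = "\<lambda>k. s + k + 1"]) auto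
  thus ?thesis using \<tau>_pos by (simp add: batch_mean_def)
qed

lemma sum_lessThan_add: "(\<Sum>k<m + n. f k) = (\<Sum>k<m. f k) + (\<Sum>k<n. f (m + k :: nat) :: real)"
  by (induction n) (simp_all add: add.assoc)

lemma sum_loss_split:
  assumes "\<tau> \<le> n"
  shows "(\<Sum>k<n. L (s + k + 1) J) = real \<tau> * batch_mean \<tau> L s J + (\<Sum>k<n - \<tau>. L (s + \<tau> + k + 1) J)"
  using sum_lessThan_add[of "\<lambda>k. L (s + k + 1) J" \<tau> "n - \<tau>"] assms sum_batch[of L s J]
  by (simp add: add.assoc)

lemma loss_sum_batch:
  assumes "\<tau> \<le> n"
  shows "loss_sum L s n (replicate \<tau> J @ I) = real \<tau> * batch_mean \<tau> L s J + loss_sum L (s + \<tau>) (n - \<tau>) I"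
proof -
  have "loss_sum L s n (replicate \<tau> J @ I) = (\<Sum>k<\<tau>. L (s + k + 1) ((replicate \<tau> J @ I) ! k))
      + (\<Sum>k<n - \<tau>. L (s + (\<tau> + k) + 1) ((replicate \<tau> J @ I) ! (\<tau> + k)))"
    unfolding loss_sum_def using sum_lessThan_add[of _ \<tau> "n - \<tau>"] assms by simp
  also have "(\<Sum>k<\<tau>. L (s + k + 1) ((replicate \<tau> J @ I) ! k)) = (\<Sum>k<\<tau>. L (s + k + 1) J)"
    by (intro sum.cong) (auto simp: nth_append)
  also have "(\<Sum>k<n - \<tau>. L (s + (\<tau> + k) + 1) ((replicate \<tau> J @ I) ! (\<tau> + k))) = loss_sum L (s + \<tau>) (n - \<tau>) I"
    unfolding loss_sum_def by (intro sum.cong) (auto simp: nth_append add.assoc)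
  finally show ?thesis unfolding sum_batch .
qed

lemma batch_mean_bounds:
  assumes "\<And>r. r \<in> {s+1..s+\<tau>} \<Longrightarrow> L r J \<in> {0..1}"
  shows "batch_mean \<tau> L s J \<in> {0..1}"
proof -
  have "(\<Sum>r=s+1..s+\<tau>. L r J) \<le> (\<Sum>r=s+1..s+\<tau>. 1)" using assms by (intro sum_mono) auto
  moreover have "(\<Sum>r=s+1..s+\<tau>. L r J) \<ge> 0" using assms by (intro sum_nonneg) auto
  ultimately show ?thesis using \<tau>_pos by (simp add: batch_mean_def)
qed

text \<open>The budget for N further batches after m completed ones, in telescoping form. The
  constant is 16 = 2 + 14, with 2 for regularisation and 14 = 2 * 42 / 6 for stability and
  skipping.\<close>

definition width :: "nat \<Rightarrow> nat \<Rightarrow> real" where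
  "width m N = 16 * sqrt 6 * sqrt (real K) * (sqrt (real (m + N)) - sqrt (real m))"

lemma width_nonneg: "width m N \<ge> 0"
  unfolding width_def by (intro mult_nonneg_nonneg) auto

lemma width_step:
  "2 * sqrt (real K) * (\<beta> (m + 1) - \<beta> m) + 42 * sqrt (real K) / \<beta> m + width (m + 1) N \<le> width m (Suc N)"
proof -
  define d where "d = sqrt 6 * sqrt (real K) * (sqrt (real (m + 1)) - sqrt (real m))"
  have "2 * sqrt (real K) * (\<beta> (m + 1) - \<beta> m) =
      2 * (sqrt 6 * sqrt (real K)) * (sqrt (real (m + 2)) - sqrt (real (m + 1)))"
    unfolding reg_weight_def by (simp add: algebra_simps)
  also have "\<dots> \<le> 2 * (sqrt 6 * sqrt (real K)) * (sqrt (real (m + 1)) - sqrt (real m))"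
    by (rule mult_left_mono[OF sqrt_diff_bounds(1)]) simp
  finally have 1: "2 * sqrt (real K) * (\<beta> (m + 1) - \<beta> m) \<le> 2 * d" by (simp add: d_def)
  have "42 * sqrt (real K) / \<beta> m = 7 * sqrt (real K) * (6 / sqrt 6) * (1 / sqrt (real (m + 1)))"
    unfolding reg_weight_def by simp
  \<comment> \<open>Here the choice of \<sigma> matches the second moment bound 6: the term gets the
    same factor sqrt 6 as the regularisation term.\<close>
  also have "6 / sqrt 6 = sqrt 6" by (rule real_div_sqrt) simp
  also have "7 * sqrt (real K) * sqrt 6 * (1 / sqrt (real (m + 1))) \<le>
      7 * sqrt (real K) * sqrt 6 * (2 * (sqrt (real (m + 1)) - sqrt (real m)))"
    by (rule mult_left_mono[OF sqrt_diff_bounds(2)]) simp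
  finally have 2: "42 * sqrt (real K) / \<beta> m \<le> 14 * d" by (simp add: d_def algebra_simps)
  have "width m (Suc N) = 16 * d + width (m + 1) N"
    unfolding width_def d_def by (simp add: algebra_simps)
  thus ?thesis using 1 2 by linarith
qed

text \<open>Minus the FTRL value of the estimated losses, shifted by the comparator's estimated loss; it pays
  for the regret still to come.\<close>

definition potential :: "(nat \<times> real) list \<Rightarrow> nat \<Rightarrow> real" where
  "potential h i = cum_loss K (sqrt 6) h i - ftrl_value K (sqrt 6) h"

lemma potential_nonneg: "i \<in> {1..K} \<Longrightarrow> potential h i \<ge> 0"
  using ftrl_value_le_cum_loss[OF K_pos, of "sqrt 6" i h] by (simp add: potential_def)

lemma potential_step:
  assumes J: "J \<in> {1..K}"
  shows "a J + potential (h @ [(J, a J + z)]) i \<le>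
    potential h i + excess h a i J z + 2 * sqrt (real K) * (\<beta> (length h + 1) - \<beta> (length h))"
proof -
  have "cum_loss K (sqrt 6) (h @ [(J, a J + z)]) i = cum_loss K (sqrt 6) h i
      + (if J = i then 1 / pmf (x h) i else 0) * trunc (r h i) (a i + z)"
    by (auto simp: cum_loss_snoc htinf_estimate_eq)
  thus ?thesis
    using ftrl_value_step[OF K_pos _ J, of "sqrt 6" h "a J + z"]
    unfolding potential_def excess_def by simp
qed

text \<open>Backward induction: one batch exchanges its loss for a decrease of the potential plus an
  excess, and after averaging over noise and action \<open>width_step\<close> pays for what exceeds
  the comparator's batch loss.\<close>

lemma nn_integral_loss_le:
  assumes i: "i \<in> {1..K}" and L: "\<And>t j. t \<in> {s+1..s+n} \<Longrightarrow> j \<in> {1..K} \<Longrightarrow> L t j \<in> {0..1}"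
  shows "(\<integral>\<^sup>+I. ennreal (loss_sum L s n I) \<partial>conv L s h n) \<le>
    ennreal ((\<Sum>k<n. L (s + k + 1) i) + real \<tau> * (potential h i + width (length h) (n div \<tau>)) + real \<tau>)"
  using L
proof (induction n arbitrary: s h rule: less_induct)
  case (less n)
  have pot: "potential h i + width (length h) N \<ge> 0" for h N
    using potential_nonneg[OF i] width_nonneg by (intro add_nonneg_nonneg) auto
  have bench: "(\<Sum>k<n. L (s + k + 1) i) \<ge> 0"
    using less.prems[OF _ i] by (intro sum_nonneg) auto
  consider "n = 0" | "0 < n" "n < \<tau>" | "n \<ge> \<tau>" by linarith
  thus ?case
  proof cases
    case 1
    thus ?thesis by (simp add: loss_sum_def)
  next
    case 2
    \<comment> \<open>Each round of an incomplete batch costs at most 1; this is the origin of the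
      final summand \<open>real \<tau>\<close>.\<close>
    have "(\<Sum>k<n. L (s + k + 1) J) \<le> real \<tau>" if "J \<in> set_pmf (x h)" for J
    proof -
      have J: "J \<in> {1..K}" using that set_pmf_B by blast
      have "(\<Sum>k<n. L (s + k + 1) J) \<le> (\<Sum>k<n. 1)"
        using less.prems[OF _ J] by (intro sum_mono) auto
      thus ?thesis using 2 by simp
    qed
    hence "(\<integral>\<^sup>+I. ennreal (loss_sum L s n I) \<partial>conv L s h n) \<le> (\<integral>\<^sup>+J. ennreal (real \<tau>) \<partial>measure_pmf (x h))"
      unfolding nn_integral_conversion_short[OF 2] loss_sum_replicate
      by (intro nn_integral_mono_AE) (auto simp: AE_measure_pmf_iff intro!: ennreal_leI)
    also have "\<dots> = ennreal (real \<tau>)" by (simp add: measure_pmf.emeasure_space_1[simplified])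
    also have "\<dots> \<le> ennreal ((\<Sum>k<n. L (s + k + 1) i)
        + real \<tau> * (potential h i + width (length h) (n div \<tau>)) + real \<tau>)"
      using bench pot by (intro ennreal_leI) simp
    finally show ?thesis .
  next
    case 3
    define m N where "m = length h" and "N = (n - \<tau>) div \<tau>"
    have N: "n div \<tau> = Suc N" using 3 \<tau>_pos by (simp add: N_def le_div_geq)
    define a where "a = batch_mean \<tau> L s"
    have a: "a J \<in> {0..1}" if "J \<in> {1..K}" for J
      unfolding a_def using less.prems[OF _ that] 3 by (intro batch_mean_bounds) auto
    \<comment> \<open>Everything in the bound that depends on neither the drawn action nor the
      noise.\<close>
    define C where "C = (\<Sum>k<n - \<tau>. L (s + \<tau> + k + 1) i)
        + real \<tau> * (potential h i + 2 * sqrt (real K) * (\<beta> (m + 1) - \<beta> m) + width (m + 1) N) + real \<tau>"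
    let ?h = "\<lambda>J z. h @ [(J, a J + z)]"
    have step: "(\<integral>\<^sup>+I. ennreal (loss_sum L s n (replicate \<tau> J @ I)) \<partial>conv L (s + \<tau>) (?h J z) (n - \<tau>))
        \<le> ennreal (C + real \<tau> * excess h a i J z)"
      and step_nonneg: "0 \<le> C + real \<tau> * excess h a i J z" if J: "J \<in> {1..K}" for J z
    proof -
      define R where "R = (\<Sum>k<n - \<tau>. L (s + \<tau> + k + 1) i)
          + real \<tau> * (potential (?h J z) i + width (m + 1) N) + real \<tau>"
      have "R \<ge> 0" unfolding R_def
        using less.prems[OF _ i] 3 potential_nonneg[OF i] width_nonneg
        by (intro add_nonneg_nonneg sum_nonneg mult_nonneg_nonneg) auto
      have ta: "real \<tau> * a J \<ge> 0" using a[OF J] by simp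
      interpret S: subprob_space "conv L (s + \<tau>) (?h J z) (n - \<tau>)"
        using conversion_subprob by (simp add: space_subprob_algebra)
      have sets: "sets (conv L (s + \<tau>) (?h J z) (n - \<tau>)) = sets (count_space UNIV)"
        using conversion_subprob by (simp add: space_subprob_algebra)
      have IH: "(\<integral>\<^sup>+I. ennreal (loss_sum L (s + \<tau>) (n - \<tau>) I) \<partial>conv L (s + \<tau>) (?h J z) (n - \<tau>)) \<le> ennreal R"
        using less.IH[of "n - \<tau>" "s + \<tau>" "?h J z"] less.prems 3 \<tau>_pos by (simp add: R_def N_def m_def)
      have "(\<integral>\<^sup>+I. ennreal (loss_sum L s n (replicate \<tau> J @ I)) \<partial>conv L (s + \<tau>) (?h J z) (n - \<tau>))
          \<le> (\<integral>\<^sup>+I. ennreal (real \<tau> * a J) + ennreal (loss_sum L (s + \<tau>) (n - \<tau>) I)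
              \<partial>conv L (s + \<tau>) (?h J z) (n - \<tau>))"
      proof (rule nn_integral_mono)
        fix I
        \<comment> \<open>The list \<open>I\<close> is arbitrary, so later losses may be read
          outside the prescribed range and be negative; \<open>ennreal\<close> cuts them off at 0,
          and subadditivity is enough.\<close>
        have "ennreal (u + v) \<le> ennreal u + ennreal v" if "u \<ge> 0" for u v
          using that by (cases "v \<ge> 0") (auto simp: ennreal_neg intro!: ennreal_leI)
        from this[OF ta] show "ennreal (loss_sum L s n (replicate \<tau> J @ I))
            \<le> ennreal (real \<tau> * a J) + ennreal (loss_sum L (s + \<tau>) (n - \<tau>) I)"
          unfolding loss_sum_batch[OF 3] a_def .
      qed
      also have "\<dots> = (\<integral>\<^sup>+I. ennreal (real \<tau> * a J) \<partial>conv L (s + \<tau>) (?h J z) (n - \<tau>))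
          + (\<integral>\<^sup>+I. ennreal (loss_sum L (s + \<tau>) (n - \<tau>) I) \<partial>conv L (s + \<tau>) (?h J z) (n - \<tau>))"
        by (rule nn_integral_add) (simp_all cong: measurable_cong_sets[OF sets refl] add: measurable_cong_sets[OF sets refl])
      also have "\<dots> \<le> ennreal (real \<tau> * a J) * 1 + ennreal R"
        unfolding nn_integral_const by (intro add_mono IH mult_left_mono S.emeasure_space_le_1) simp
      also have "\<dots> = ennreal (real \<tau> * a J + R)" using \<open>R \<ge> 0\<close> ta by simp
      finally have le: "(\<integral>\<^sup>+I. ennreal (loss_sum L s n (replicate \<tau> J @ I)) \<partial>conv L (s + \<tau>) (?h J z) (n - \<tau>))
          \<le> ennreal (real \<tau> * a J + R)" .
      have "real \<tau> * (a J + potential (?h J z) i) \<le>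
          real \<tau> * (potential h i + excess h a i J z + 2 * sqrt (real K) * (\<beta> (m + 1) - \<beta> m))"
        unfolding m_def by (rule mult_left_mono[OF potential_step[OF J]]) simp
      hence real_le: "real \<tau> * a J + R \<le> C + real \<tau> * excess h a i J z"
        unfolding R_def C_def by (simp add: algebra_simps)
      show "(\<integral>\<^sup>+I. ennreal (loss_sum L s n (replicate \<tau> J @ I)) \<partial>conv L (s + \<tau>) (?h J z) (n - \<tau>))
        \<le> ennreal (C + real \<tau> * excess h a i J z)"
        using le ennreal_leI[OF real_le] by (rule order_trans)
      \<comment> \<open>Although \<open>excess\<close> itself may be negative, the sum dominates a
        nonnegative quantity, so its nonnegative integral equals a Bochner integral and becomes
        linear.\<close>
      show "0 \<le> C + real \<tau> * excess h a i J z" using real_le ta \<open>R \<ge> 0\<close> by linarith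
    qed
    interpret Nz: prob_space noise by (rule prob_space_laplace[OF noise_scale_pos])
    define E where "E J = (\<integral>z. excess h a i J z \<partial>noise)" for J
    have int: "integrable noise (excess h a i J)" if "J \<in> {1..K}" for J
      using excess_integral(1)[OF a i that] .
    have E_nonneg: "0 \<le> C + real \<tau> * E J"
      and E_eq: "(\<integral>\<^sup>+z. ennreal (C + real \<tau> * excess h a i J z) \<partial>noise) = ennreal (C + real \<tau> * E J)"
      if J: "J \<in> {1..K}" for J
    proof -
      have eq: "(\<integral>z. C + real \<tau> * excess h a i J z \<partial>noise) = C + real \<tau> * E J"
        using int[OF J] by (simp add: E_def Nz.prob_space[simplified])
      have "0 \<le> (\<integral>z. C + real \<tau> * excess h a i J z \<partial>noise)"
        by (rule Bochner_Integration.integral_nonneg[OF step_nonneg[OF J]])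
      thus "0 \<le> C + real \<tau> * E J" unfolding eq .
      show "(\<integral>\<^sup>+z. ennreal (C + real \<tau> * excess h a i J z) \<partial>noise) = ennreal (C + real \<tau> * E J)"
        unfolding eq[symmetric] using int[OF J] step_nonneg[OF J]
        by (intro nn_integral_eq_integral) auto
    qed
    have "(\<integral>\<^sup>+I. ennreal (loss_sum L s n I) \<partial>conv L s h n) \<le>
        (\<integral>\<^sup>+J. ennreal (C + real \<tau> * E J) \<partial>measure_pmf (x h))"
      unfolding nn_integral_conversion_batch[OF 3]
    proof (rule nn_integral_mono_AE, unfold AE_measure_pmf_iff, intro ballI)
      fix J assume "J \<in> set_pmf (x h)"
      hence J: "J \<in> {1..K}" using set_pmf_B by blast
      show "(\<integral>\<^sup>+Z. \<integral>\<^sup>+I. ennreal (loss_sum L s n (replicate \<tau> J @ I))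
          \<partial>conv L (s + \<tau>) (h @ [(J, batch_mean \<tau> L s J + Z)]) (n - \<tau>) \<partial>noise) \<le> ennreal (C + real \<tau> * E J)"
        unfolding E_eq[OF J, symmetric] using step[OF J] by (intro nn_integral_mono) (simp add: a_def)
    qed
    also have "\<dots> = (\<Sum>J=1..K. ennreal (C + real \<tau> * E J) * ennreal (pmf (x h) J))"
      using set_pmf_B[of h] by (intro nn_integral_measure_pmf_support) auto
    also have "\<dots> = (\<Sum>J=1..K. ennreal (pmf (x h) J * (C + real \<tau> * E J)))"
      using E_nonneg by (intro sum.cong refl) (simp add: ennreal_mult mult.commute)
    also have "\<dots> = ennreal (\<Sum>J=1..K. pmf (x h) J * (C + real \<tau> * E J))"
      using E_nonneg by (intro sum_ennreal) simp
    also have "(\<Sum>J=1..K. pmf (x h) J * (C + real \<tau> * E J)) =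
        C * (\<Sum>J=1..K. pmf (x h) J) + real \<tau> * (\<Sum>J=1..K. pmf (x h) J * E J)"
      by (simp add: algebra_simps sum.distrib sum_distrib_left)
    also have "(\<Sum>J=1..K. pmf (x h) J) = 1" by (rule sum_pmf_action_dists[OF htinf_action_dists[OF K_pos]])
    also have "ennreal (C * 1 + real \<tau> * (\<Sum>J=1..K. pmf (x h) J * E J)) \<le>
        ennreal ((\<Sum>k<n. L (s + k + 1) i) + real \<tau> * (potential h i + width (length h) (n div \<tau>)) + real \<tau>)"
    proof (rule ennreal_leI)
      have "(\<Sum>J=1..K. pmf (x h) J * E J) \<le> a i + 42 * sqrt (real K) / \<beta> m"
        unfolding E_def m_def by (rule excess_integral(2)[OF a i])
      hence "(2 * sqrt (real K) * (\<beta> (m + 1) - \<beta> m) + width (m + 1) N) + (\<Sum>J=1..K. pmf (x h) J * E J)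
          \<le> a i + width m (Suc N)"
        using width_step[of m N] by linarith
      hence "real \<tau> * ((2 * sqrt (real K) * (\<beta> (m + 1) - \<beta> m) + width (m + 1) N) + (\<Sum>J=1..K. pmf (x h) J * E J))
          \<le> real \<tau> * (a i + width m (Suc N))" by (rule mult_left_mono) simp
      thus "C * 1 + real \<tau> * (\<Sum>J=1..K. pmf (x h) J * E J) \<le>
        (\<Sum>k<n. L (s + k + 1) i) + real \<tau> * (potential h i + width (length h) (n div \<tau>)) + real \<tau>"
        unfolding sum_loss_split[OF 3] N C_def a_def[symmetric] m_def[symmetric] by (simp add: algebra_simps)
    qed
    finally show ?thesis .
  qed
qed

section \<open>From the induction to the stated rate\<close>

lemma expected_regret_le:
  assumes "L \<in> loss_seqs K T"
  shows "expected_regret K (private_conversion (htinf K (sqrt 6)) \<tau> \<epsilon>) T L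
    \<le> real \<tau> * (2 * sqrt 6 * sqrt (real K) + 16 * sqrt 6 * sqrt (real K) * sqrt (real (T div \<tau>))) + real \<tau>"
    (is "_ \<le> ?R")
proof -
  let ?M = "private_conversion (htinf K (sqrt 6)) \<tau> \<epsilon> T L"
  have L: "L t j \<in> {0..1}" if "t \<in> {0 + 1..0 + T}" "j \<in> {1..K}" for t j
    using assms that by (simp add: loss_seqs_def)
  have shift: "(\<Sum>t=1..T. f t) = (\<Sum>k<T. f (k + 1))" for f :: "nat \<Rightarrow> real"
    by (rule sum.reindex_bij_witness[where j = "\<lambda>t. t - 1" and i = "\<lambda>k. k + 1"]) auto
  have bound: "(\<integral>I. (\<Sum>t=1..T. L t (I ! (t - 1))) \<partial>?M) - ?R \<le> (\<Sum>t=1..T. L t i)" if i: "i \<in> {1..K}" for i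
  proof -
    have "potential [] i \<le> 2 * sqrt 6 * sqrt (real K)"
      using ftrl_value_Nil_ge[OF K_pos, of "sqrt 6"] by (simp add: potential_def)
    hence "real \<tau> * (potential [] i + width 0 (T div \<tau>)) \<le>
        real \<tau> * (2 * sqrt 6 * sqrt (real K) + 16 * sqrt 6 * sqrt (real K) * sqrt (real (T div \<tau>)))"
      by (intro mult_left_mono add_mono) (simp_all add: width_def)
    hence le: "(\<Sum>k<T. L (0 + k + 1) i) + real \<tau> * (potential [] i + width (length ([] :: (nat \<times> real) list)) (T div \<tau>))
        + real \<tau> \<le> (\<Sum>t=1..T. L t i) + ?R"
      unfolding shift by simp
    \<comment> \<open>Needed to turn a bound on the nonnegative integral into one on the Bochner
      integral, which is 0 by convention for a non-integrable function.\<close>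
    have nonneg: "0 \<le> (\<Sum>t=1..T. L t i) + ?R"
      using L[OF _ i] by (intro add_nonneg_nonneg sum_nonneg mult_nonneg_nonneg) auto
    have "(\<integral>\<^sup>+I. ennreal (\<Sum>t=1..T. L t (I ! (t - 1))) \<partial>?M) \<le> ennreal ((\<Sum>t=1..T. L t i) + ?R)"
      using order_trans[OF nn_integral_loss_le[where s = 0 and h = "[]" and L = L and n = T, OF i L] ennreal_leI[OF le]]
      unfolding private_conversion_def shift by (simp add: loss_sum_def)
    from integral_real_bounded[OF nonneg this] show ?thesis by simp
  qed
  have "(\<integral>I. (\<Sum>t=1..T. L t (I ! (t - 1))) \<partial>?M) - ?R \<le> (INF i\<in>{1..K}. \<Sum>t=1..T. L t i)"
    using K_pos by (intro cINF_greatest bound) auto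
  thus ?thesis unfolding expected_regret_def by simp
qed

end

theorem corollary2:
  "\<exists>C::real. \<forall>(K::nat) (T::nat) (\<epsilon>::real).
     K \<ge> 1 \<longrightarrow> T \<ge> 1 \<longrightarrow> 1 / real T \<le> \<epsilon> \<longrightarrow> \<epsilon> \<le> 1 \<longrightarrow>
     (let P = private_conversion (htinf K (sqrt 6)) (nat \<lceil>1 / \<epsilon>\<rceil>) \<epsilon> in
        differentially_private K \<epsilon> P \<and>
        worst_case_regret K P T \<le> ereal (C * (sqrt (real T * real K) / sqrt \<epsilon> + 1 / \<epsilon>)))"
proof (intro exI[of _ 100] allI impI)
  fix K T :: nat and \<epsilon> :: real
  assume K: "K \<ge> 1" and T: "T \<ge> 1" and \<epsilon>: "1 / real T \<le> \<epsilon>" "\<epsilon> \<le> 1"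
  define \<tau> where "\<tau> = nat \<lceil>1 / \<epsilon>\<rceil>"
  have "0 < 1 / real T" using T by simp
  hence \<epsilon>_pos: "\<epsilon> > 0" using \<epsilon>(1) by linarith
  have inv: "1 / \<epsilon> \<ge> 1" using \<epsilon>(2) \<epsilon>_pos by simp
  have \<tau>_ge: "1 / \<epsilon> \<le> real \<tau>" unfolding \<tau>_def by (rule real_nat_ceiling_ge)
  have "real \<tau> \<le> 1 / \<epsilon> + 1" unfolding \<tau>_def using inv by (simp add: of_nat_nat ceiling_le_iff)
  hence \<tau>_le: "real \<tau> \<le> 2 / \<epsilon>" using inv by simp
  have \<tau>_pos: "\<tau> \<ge> 1" using \<tau>_ge inv by linarith
  have "1 / \<epsilon> \<le> real T" using \<epsilon>(1) \<epsilon>_pos T by (simp add: field_simps)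
  \<comment> \<open>Here \<epsilon> \<ge> 1 / T enters: at least one batch is complete, so sqrt N
    \<ge> 1 can absorb the initial potential.\<close>
  hence "\<tau> \<le> T" unfolding \<tau>_def by (simp add: ceiling_le_iff)
  define N where "N = T div \<tau>"
  have N: "N \<ge> 1" using \<open>\<tau> \<le> T\<close> \<tau>_pos by (simp add: N_def Suc_leI div_greater_zero_iff)
  interpret htinf_conversion K \<tau> \<epsilon>
    by standard (use K \<tau>_pos \<epsilon>_pos \<tau>_ge in \<open>auto simp: field_simps\<close>)
  let ?P = "private_conversion (htinf K (sqrt 6)) \<tau> \<epsilon>"
  have sqrt6: "sqrt 6 \<le> 5 / 2" by (rule real_le_lsqrt) (auto simp: power2_eq_square)
  have sqrt2: "sqrt 2 \<le> 3 / 2" by (rule real_le_lsqrt) (auto simp: power2_eq_square)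
  \<comment> \<open>The left-hand side is the square root of \<tau> * (\<tau> * N), where \<tau>
    \<le> 2 / \<epsilon> and \<tau> * N \<le> T.\<close>
  have "real \<tau> * sqrt (real N) \<le> sqrt 2 * sqrt (real T) / sqrt \<epsilon>"
  proof -
    have "real \<tau> * real N \<le> real T"
      unfolding N_def by (metis of_nat_le_iff of_nat_mult times_div_less_eq_dividend)
    hence "real \<tau> * (real \<tau> * real N) \<le> 2 / \<epsilon> * real T" using \<tau>_le \<epsilon>_pos by (intro mult_mono) auto
    hence "sqrt (real \<tau> * real \<tau> * real N) \<le> sqrt (2 / \<epsilon> * real T)" by (simp add: mult.assoc)
    thus ?thesis by (simp add: real_sqrt_mult real_sqrt_divide)
  qed
  also have "\<dots> \<le> 3 / 2 * sqrt (real T) / sqrt \<epsilon>"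
    using sqrt2 \<epsilon>_pos by (intro divide_right_mono mult_right_mono) auto
  finally have \<tau>N: "real \<tau> * sqrt (real N) \<le> 3 / 2 * (sqrt (real T) / sqrt \<epsilon>)" by simp
  have regret: "expected_regret K ?P T L \<le> 100 * (sqrt (real T * real K) / sqrt \<epsilon> + 1 / \<epsilon>)"
    if "L \<in> loss_seqs K T" for L
  proof -
    have "expected_regret K ?P T L \<le> real \<tau> * (2 * sqrt 6 * sqrt (real K) * 1 + 16 * sqrt 6 * sqrt (real K) * sqrt (real N)) + real \<tau>"
      using expected_regret_le[OF that] by (simp add: N_def)
    also have "\<dots> \<le> real \<tau> * (2 * sqrt 6 * sqrt (real K) * sqrt (real N) + 16 * sqrt 6 * sqrt (real K) * sqrt (real N)) + real \<tau>"
      using N by (intro add_mono mult_left_mono) auto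
    also have "\<dots> = 18 * sqrt 6 * sqrt (real K) * (real \<tau> * sqrt (real N)) + real \<tau>" by (simp add: algebra_simps)
    also have "\<dots> \<le> 18 * (5 / 2) * sqrt (real K) * (3 / 2 * (sqrt (real T) / sqrt \<epsilon>)) + 2 / \<epsilon>"
    proof (rule add_mono[OF _ \<tau>_le])
      show "18 * sqrt 6 * sqrt (real K) * (real \<tau> * sqrt (real N))
          \<le> 18 * (5 / 2) * sqrt (real K) * (3 / 2 * (sqrt (real T) / sqrt \<epsilon>))"
      proof (rule mult_mono[OF _ \<tau>N])
        show "18 * sqrt 6 * sqrt (real K) \<le> 18 * (5 / 2) * sqrt (real K)"
          using sqrt6 by (intro mult_right_mono) auto
      qed simp_all
    qed
    \<comment> \<open>18 * (5 / 2) * (3 / 2) = 135 / 2, where 18 = 2 + 16 joins initial potential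
      and \<open>width\<close>; 100 is a round bound for both coefficients.\<close>
    also have "\<dots> = 135 / 2 * (sqrt (real T * real K) / sqrt \<epsilon>) + 2 * (1 / \<epsilon>)"
      by (simp add: real_sqrt_mult)
    also have "\<dots> \<le> 100 * (sqrt (real T * real K) / sqrt \<epsilon>) + 100 * (1 / \<epsilon>)"
      using \<epsilon>_pos by (intro add_mono mult_right_mono) auto
    finally show ?thesis by (simp only: distrib_left)
  qed
  hence "worst_case_regret K ?P T \<le> ereal (100 * (sqrt (real T * real K) / sqrt \<epsilon> + 1 / \<epsilon>))"
    unfolding worst_case_regret_def by (intro SUP_least) simp
  thus "let P = private_conversion (htinf K (sqrt 6)) (nat \<lceil>1 / \<epsilon>\<rceil>) \<epsilon> in
        differentially_private K \<epsilon> P \<and>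
        worst_case_regret K P T \<le> ereal (100 * (sqrt (real T * real K) / sqrt \<epsilon> + 1 / \<epsilon>))"
    unfolding Let_def \<tau>_def[symmetric] using private_conversion_differentially_private by blast
qed

end
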